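(* Let $k$ be a field of characteristic zero, and let $e_2(3)$ be the largest integer $e$ such that all artinian level algebras over $k$ of codimension $3$, type $2$ and socle degree $\le e$ enjoy the Weak Lefschetz Property. Then $e_2(3)=3$.
   Context: All algebras are standard graded $k$-algebras $A=\bigoplus_{i\ge 0}A_i$ (quotients of polynomial rings by homogeneous ideals). The codimension of an artinian $A$ is $\dim_k A_1$. An artinian algebra $A$ is level of type $t$ if its socle has dimension $t$ and is concentrated in one degree, namely the last degree in which $A$ is non-zero; this last degree is the socle degree. $A$ has the Weak Lefschetz Property if for a general linear form $L\in A_1$ (i.e. for all $L$ in some non-empty Zariski-open subset of $A_1$) the multiplication map $\times L:A_i\to A_{i+1}$ has maximal rank (is injective or surjective) for every $i$. *)

theory Defs
  imports
    "HOL-Library.Poly_Mapping"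
    "HOL-Algebra.Ideal"
    "HOL-Algebra.QuotRing"
    "HOL-Algebra.Embedded_Algebras"
begin

section \<open>Standard graded algebras as quotients of polynomial rings\<close>

text \<open>A polynomial maps monomials to coefficients, a monomial maps (indices of) variables to
  exponents.\<close>

type_synonym 'k mpoly = "(nat \<Rightarrow>\<^sub>0 nat) \<Rightarrow>\<^sub>0 'k"

definition polynomial_ring :: "nat \<Rightarrow> 'k::field mpoly ring" where
  "polynomial_ring n =
     \<lparr>carrier = {f. \<forall>m\<in>Poly_Mapping.keys f. Poly_Mapping.keys m \<subseteq> {..<n}},
      mult = (*), one = 1, zero = 0, add = (+)\<rparr>"

lemma polynomial_ring_cring: "cring (polynomial_ring n :: 'k::field mpoly ring)"
proof -
  let ?P = "\<lambda>f :: 'k mpoly. \<forall>m\<in>Poly_Mapping.keys f. Poly_Mapping.keys m \<subseteq> {..<n}"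
  have add: "?P (f + g)" if "?P f" "?P g" for f g
    using that Poly_Mapping.keys_add[of f g] by blast
  have mult: "?P (f * g)" if fg: "?P f" "?P g" for f g
  proof
    fix m assume "m \<in> Poly_Mapping.keys (f * g)"
    then obtain a b where "m = a + b" "a \<in> Poly_Mapping.keys f" "b \<in> Poly_Mapping.keys g"
      using keys_mult[of f g] by blast
    then show "Poly_Mapping.keys m \<subseteq> {..<n}"
      using fg Poly_Mapping.keys_add[of a b] by blast
  qed
  have neg: "?P (- f)" if "?P f" for f
    using that by (simp add: keys_def)
  let ?R = "polynomial_ring n :: 'k mpoly ring"
  have carrier: "f \<in> carrier ?R \<longleftrightarrow> ?P f" for f
    by (simp add: polynomial_ring_def)
  have ops: "mult ?R = (*)" "add ?R = (+)" "one ?R = 1" "zero ?R = 0"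
    by (simp_all add: polynomial_ring_def)
  have "abelian_group ?R"
  proof (rule abelian_groupI)
    show "\<exists>y\<in>carrier ?R. y \<oplus>\<^bsub>?R\<^esub> x = \<zero>\<^bsub>?R\<^esub>" if "x \<in> carrier ?R" for x
      unfolding ops using neg[of x] that carrier by (metis add.left_inverse)
    show "x \<oplus>\<^bsub>?R\<^esub> y \<in> carrier ?R" if "x \<in> carrier ?R" "y \<in> carrier ?R" for x y
      unfolding ops carrier using that[unfolded carrier] by (rule add)
    show "\<zero>\<^bsub>?R\<^esub> \<in> carrier ?R"
      unfolding ops carrier by simp
  qed (simp_all add: ops add_ac)
  moreover have "comm_monoid ?R"
  proof (rule comm_monoidI)
    show "x \<otimes>\<^bsub>?R\<^esub> y \<in> carrier ?R" if "x \<in> carrier ?R" "y \<in> carrier ?R" for x y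
      unfolding ops carrier using that[unfolded carrier] by (rule mult)
    show "\<one>\<^bsub>?R\<^esub> \<in> carrier ?R"
      unfolding ops carrier by simp
  qed (simp_all add: ops mult_ac)
  ultimately show ?thesis
    by (rule cringI) (simp only: ops distrib_right)
qed

definition total_degree :: "(nat \<Rightarrow>\<^sub>0 nat) \<Rightarrow> nat" where
  "total_degree m = (\<Sum>i\<in>Poly_Mapping.keys m. Poly_Mapping.lookup m i)"

definition forms :: "nat \<Rightarrow> nat \<Rightarrow> 'k::field mpoly set" where
  "forms n d =
     {f \<in> carrier (polynomial_ring n). \<forall>m\<in>Poly_Mapping.keys f. total_degree m = d}"

definition homogeneous_ideal :: "nat \<Rightarrow> 'k::field mpoly set \<Rightarrow> bool" where
  "homogeneous_ideal n I \<longleftrightarrow> (\<exists>H \<subseteq> (\<Union>d. forms n d). I = Idl\<^bsub>polynomial_ring n\<^esub> H)"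

definition quotient_grading :: "nat \<Rightarrow> 'k::field mpoly set \<Rightarrow> nat \<Rightarrow> 'k mpoly set set" where
  "quotient_grading n I d = (\<lambda>f. I +>\<^bsub>polynomial_ring n\<^esub> f) ` forms n d"


section \<open>Artinian level algebras\<close>

text \<open>In what follows a graded algebra is a ring \<open>A\<close> with its homogeneous components
  \<open>gr 0, gr 1, \<dots>\<close>. The ground field is the subring \<open>gr 0\<close>: in a non-zero quotient of
  \<open>k[x\<^sub>0,\<dots>,x\<^sub>n\<^sub>-\<^sub>1]\<close> by a homogeneous ideal, \<open>gr 0\<close> consists of the classes of the constants and is
  a copy of \<open>k\<close>.\<close>

definition artinian :: "('a, 'b) ring_scheme \<Rightarrow> bool" where
  "artinian A \<longleftrightarrow>
     (\<forall>J :: nat \<Rightarrow> 'a set. (\<forall>i. ideal (J i) A) \<and> (\<forall>i. J (Suc i) \<subseteq> J i) \<longrightarrow>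
        (\<exists>N. \<forall>i\<ge>N. J i = J N))"

definition codimension ::
    "('a, 'b) ring_scheme \<Rightarrow> (nat \<Rightarrow> 'a set) \<Rightarrow> nat \<Rightarrow> bool" where
  "codimension A gr r \<longleftrightarrow> ring.dimension A r (gr 0) (gr 1)"

text \<open>The socle is the annihilator of the homogeneous maximal ideal, which is the sum of the
  components of positive degree.\<close>

definition socle :: "('a, 'b) ring_scheme \<Rightarrow> (nat \<Rightarrow> 'a set) \<Rightarrow> 'a set" where
  "socle A gr = {x \<in> carrier A. \<forall>i\<ge>1. \<forall>y\<in>gr i. y \<otimes>\<^bsub>A\<^esub> x = \<zero>\<^bsub>A\<^esub>}"

definition socle_degree ::
    "('a, 'b) ring_scheme \<Rightarrow> (nat \<Rightarrow> 'a set) \<Rightarrow> nat \<Rightarrow> bool" where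
  "socle_degree A gr s \<longleftrightarrow> gr s \<noteq> {\<zero>\<^bsub>A\<^esub>} \<and> (\<forall>d>s. gr d = {\<zero>\<^bsub>A\<^esub>})"

definition level ::
    "('a, 'b) ring_scheme \<Rightarrow> (nat \<Rightarrow> 'a set) \<Rightarrow> nat \<Rightarrow> nat \<Rightarrow> bool" where
  "level A gr t s \<longleftrightarrow>
     socle_degree A gr s \<and> socle A gr \<subseteq> gr s \<and> ring.dimension A t (gr 0) (socle A gr)"


section \<open>The Weak Lefschetz Property\<close>

definition linear_functional ::
    "('a, 'b) ring_scheme \<Rightarrow> 'a set \<Rightarrow> 'a set \<Rightarrow> ('a \<Rightarrow> 'a) \<Rightarrow> bool" where
  "linear_functional A K V \<phi> \<longleftrightarrow>
     (\<forall>x\<in>V. \<phi> x \<in> K) \<and>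
     (\<forall>x\<in>V. \<forall>y\<in>V. \<phi> (x \<oplus>\<^bsub>A\<^esub> y) = \<phi> x \<oplus>\<^bsub>A\<^esub> \<phi> y) \<and>
     (\<forall>c\<in>K. \<forall>x\<in>V. \<phi> (c \<otimes>\<^bsub>A\<^esub> x) = c \<otimes>\<^bsub>A\<^esub> \<phi> x)"

text \<open>Polynomial functions on a finite-dimensional \<open>K\<close>-subspace \<open>V\<close> of \<open>A\<close>, without a choice of
  coordinates: the \<open>K\<close>-algebra of functions generated by the linear functionals. Only the values
  on \<open>V\<close> matter.\<close>

inductive_set polynomial_functions ::
    "('a, 'b) ring_scheme \<Rightarrow> 'a set \<Rightarrow> 'a set \<Rightarrow> ('a \<Rightarrow> 'a) set"
  for A :: "('a, 'b) ring_scheme" and K V :: "'a set" where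
  const: "c \<in> K \<Longrightarrow> (\<lambda>_. c) \<in> polynomial_functions A K V"
| linear: "linear_functional A K V \<phi> \<Longrightarrow> \<phi> \<in> polynomial_functions A K V"
| add: "p \<in> polynomial_functions A K V \<Longrightarrow> q \<in> polynomial_functions A K V \<Longrightarrow>
    (\<lambda>x. p x \<oplus>\<^bsub>A\<^esub> q x) \<in> polynomial_functions A K V"
| mult: "p \<in> polynomial_functions A K V \<Longrightarrow> q \<in> polynomial_functions A K V \<Longrightarrow>
    (\<lambda>x. p x \<otimes>\<^bsub>A\<^esub> q x) \<in> polynomial_functions A K V"

definition zariski_open ::
    "('a, 'b) ring_scheme \<Rightarrow> 'a set \<Rightarrow> 'a set \<Rightarrow> 'a set \<Rightarrow> bool" where
  "zariski_open A K V U \<longleftrightarrow>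
     (\<exists>F \<subseteq> polynomial_functions A K V. U = {x \<in> V. \<exists>p\<in>F. p x \<noteq> \<zero>\<^bsub>A\<^esub>})"

definition maximal_rank ::
    "('a, 'b) ring_scheme \<Rightarrow> (nat \<Rightarrow> 'a set) \<Rightarrow> 'a \<Rightarrow> nat \<Rightarrow> bool" where
  "maximal_rank A gr L i \<longleftrightarrow>
     inj_on (\<lambda>x. L \<otimes>\<^bsub>A\<^esub> x) (gr i) \<or> (\<lambda>x. L \<otimes>\<^bsub>A\<^esub> x) ` gr i = gr (Suc i)"

definition weak_lefschetz :: "('a, 'b) ring_scheme \<Rightarrow> (nat \<Rightarrow> 'a set) \<Rightarrow> bool" where
  "weak_lefschetz A gr \<longleftrightarrow>
     (\<exists>U. zariski_open A (gr 0) (gr 1) U \<and> U \<noteq> {} \<and> (\<forall>L\<in>U. \<forall>i. maximal_rank A gr L i))"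


section \<open>The invariant $e_t(r)$\<close>

definition level_algebras_weak_lefschetz ::
    "'k::field itself \<Rightarrow> nat \<Rightarrow> nat \<Rightarrow> int \<Rightarrow> bool" where
  "level_algebras_weak_lefschetz TYPE('k) t r e \<longleftrightarrow>
     (\<forall>n (I :: 'k mpoly set) s.
        let A = polynomial_ring n Quot I; gr = quotient_grading n I in
        homogeneous_ideal n I \<and> artinian A \<and> codimension A gr r \<and> level A gr t s \<and> int s \<le> e
        \<longrightarrow> weak_lefschetz A gr)"

text \<open>\<open>e\<close> is \<open>e\<^sub>t(r)\<close> over \<open>k\<close>. This is a relation rather than a function because the largest
  integer need not exist for all \<open>t\<close> and \<open>r\<close>.\<close>

definition is_e :: "'k::field itself \<Rightarrow> nat \<Rightarrow> nat \<Rightarrow> int \<Rightarrow> bool" where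
  "is_e TYPE('k) t r e \<longleftrightarrow>
     level_algebras_weak_lefschetz TYPE('k) t r e \<and>
     (\<forall>e'. level_algebras_weak_lefschetz TYPE('k) t r e' \<longrightarrow> e' \<le> e)"

end

theory Submission
  imports Defs "HOL-Analysis.Determinants" "HOL-Computational_Algebra.Polynomial"
begin

text \<open>For \<open>e\<^sub>2(3) \<ge> 3\<close>: a level algebra of socle degree \<open>s\<close> is determined by the pairing with its
  two-dimensional socle, so in coordinates on \<open>A\<^sub>1\<close> everything is expressed by two functionals on
  \<open>A\<^sub>s\<close>. If every \<open>L : A\<^sub>s\<^sub>-\<^sub>1 \<rightarrow> A\<^sub>s\<close> had rank at most one, the classification of linear spaces of
  maps of rank one would produce a socle element in degree one or confine \<open>A\<^sub>s\<close> to a line. If, for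
  \<open>s = 3\<close>, every \<open>L : A\<^sub>1 \<rightarrow> A\<^sub>2\<close> had a kernel, then for generic \<open>L\<close> the kernel vector \<open>M\<close> satisfies
  \<open>LM = 0\<close> and, by deforming \<open>L\<close>, also \<open>M\<^sup>2 = 0\<close>; completing \<open>L, M\<close> to a basis by \<open>N\<close> and comparing
  the kernels of \<open>L + N\<close> and \<open>L - N\<close> gives a contradiction. Both conditions are non-vanishing of
  polynomials in the coefficients of \<open>L\<close>.

  For \<open>e\<^sub>2(3) \<le> 3\<close>: the ideal \<open>(x\<^sup>3, y\<^sup>3, z\<^sup>3, xyz)\<close> fails the Weak Lefschetz Property from degree two to
  degree three, since \<open>ax + by + cz\<close> divides
  \<open>(ax)\<^sup>3 + (by)\<^sup>3 + (cz)\<^sup>3 - 3(ax)(by)(cz)\<close>. Its quotient has socle of dimension three in degree four;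
  adding the relation \<open>x\<^sup>2y\<^sup>2 + x\<^sup>2z\<^sup>2 + y\<^sup>2z\<^sup>2\<close> makes the type two without changing degrees two and
  three (Hilbert function 1, 3, 6, 6, 2).\<close>

section \<open>Linear algebra in three dimensions\<close>

text \<open>Over an arbitrary field, \<open>dot a\<close> serves as the linear functional with
  coefficient vector \<open>a\<close>, and \<open>cross a b\<close> collects the 2 x 2 minors of the
  matrix with rows \<open>a\<close> and \<open>b\<close>.\<close>

definition dot :: "'a::field^3 \<Rightarrow> 'a^3 \<Rightarrow> 'a" where
  "dot a b = a$1 * b$1 + a$2 * b$2 + a$3 * b$3"

definition cross :: "'a::field^3 \<Rightarrow> 'a^3 \<Rightarrow> 'a^3" where
  "cross a b = vector [a$2 * b$3 - a$3 * b$2, a$3 * b$1 - a$1 * b$3, a$1 * b$2 - a$2 * b$1]"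

lemma cross_component [simp]:
  "cross a b $ 1 = a$2 * b$3 - a$3 * b$2"
  "cross a b $ 2 = a$3 * b$1 - a$1 * b$3"
  "cross a b $ 3 = a$1 * b$2 - a$2 * b$1"
  by (simp_all add: cross_def vector_3)

lemma dot_linear [simp]:
  "dot a 0 = 0" "dot 0 b = 0"
  "dot a (b + c) = dot a b + dot a c" "dot (a + b) c = dot a c + dot b c"
  "dot a (s *s b) = s * dot a b" "dot (s *s a) b = s * dot a b"
  by (simp_all add: dot_def algebra_simps)

lemma dot_commute: "dot a b = dot b a"
  by (simp add: dot_def algebra_simps)

lemma dot_cross_self [simp]: "dot a (cross a b) = 0" "dot b (cross a b) = 0"
  by (simp_all add: dot_def algebra_simps)

lemma dot_axis [simp]: "dot a (axis i 1) = a $ i"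
  by (use exhaust_3[of i] in \<open>auto simp: dot_def axis_def\<close>)

lemma vec3_expand: "v = v$1 *s axis 1 1 + v$2 *s axis 2 1 + v$3 *s axis 3 1"
  for v :: "'a::field^3"
  by (simp add: vec_eq_iff forall_3 axis_def)

lemma dot_nondegenerate: "\<exists>p. dot w p \<noteq> 0" if "w \<noteq> 0"
  using that dot_axis[of w] by (metis vec_eq_iff zero_index)

text \<open>Cramer's rule cleared of denominators: \<open>dot (cross l m) n\<close> is the
  determinant of the three vectors, so they span as soon as it is non-zero.\<close>

lemma cramer_span:
  "dot (cross l m) n *s v = dot (cross m n) v *s l + dot (cross n l) v *s m + dot (cross l m) v *s n"
  by (simp add: vec_eq_iff forall_3 dot_def algebra_simps)

text \<open>The companion of \<open>cramer_span\<close> for three functionals: if their determinant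
  is non-zero, their values at \<open>v\<close> determine \<open>v\<close>.\<close>

lemma cramer_dual:
  "dot (cross a b) c *s v = dot a v *s cross b c + dot b v *s cross c a + dot c v *s cross a b"
  by (simp add: vec_eq_iff forall_3 dot_def algebra_simps)

lemma parallel_if_cross_eq_0:
  assumes "cross w x = 0" "w \<noteq> 0"
  shows "\<exists>c. x = c *s w"
proof -
  have eq: "w$2 * x$3 = w$3 * x$2" "w$3 * x$1 = w$1 * x$3" "w$1 * x$2 = w$2 * x$1"
    using assms(1) by (simp_all add: vec_eq_iff forall_3)
  have "w$1 \<noteq> 0 \<or> w$2 \<noteq> 0 \<or> w$3 \<noteq> 0"
    using assms(2) by (simp add: vec_eq_iff forall_3)
  moreover have "x = (x$i / w$i) *s w" if "w$i \<noteq> 0" for i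
    using that eq exhaust_3[of i] by (auto simp: vec_eq_iff forall_3 field_simps)
  ultimately show ?thesis by blast
qed

lemma kernel_of_two_functionals:
  assumes "cross a b \<noteq> 0" "dot a x = 0" "dot b x = 0"
  shows "\<exists>c. x = c *s cross a b"
proof (rule parallel_if_cross_eq_0)
  have "cross (cross a b) x = dot a x *s b - dot b x *s a"
    by (simp add: vec_eq_iff forall_3 dot_def algebra_simps)
  then show "cross (cross a b) x = 0" using assms by simp
qed fact

text \<open>The square matrix with rows \<open>a\<close>, \<open>b\<close>, \<open>0\<close> is
  singular. Unlike \<open>cross a b\<close>, its kernel vector is non-zero also when
  \<open>a\<close> and \<open>b\<close> are proportional.\<close>

lemma two_functionals_common_zero: "\<exists>x. x \<noteq> 0 \<and> dot a x = 0 \<and> dot b x = 0"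
proof -
  let ?A = "vector [a, b, 0] :: 'a^3^3"
  have "det ?A = 0" by (simp add: det_3 vector_3)
  then have "\<not> (\<exists>B. B ** ?A = mat 1)"
    using invertible_det_nz[of ?A] invertible_left_inverse by blast
  then obtain x where x: "?A *v x = 0" "x \<noteq> 0"
    using matrix_left_invertible_ker[of ?A] by blast
  then have "dot a x = 0" "dot b x = 0"
    by (simp_all add: vec_eq_iff forall_3 matrix_vector_mult_def sum_3 vector_3 dot_def)
  then show ?thesis using x(2) by blast
qed

section \<open>Linear families of maps of rank at most one\<close>

lemma rank_one_family_step:
  fixes \<beta> :: "'v::plus \<Rightarrow> 'y \<Rightarrow> 'j \<Rightarrow> 'k::field"
  assumes add: "\<And>l m y j. \<beta> (l + m) y j = \<beta> l y j + \<beta> m y j"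
    and rank: "\<And>l y z i j. \<beta> l y i * \<beta> l z j = \<beta> l y j * \<beta> l z i"
    and l: "\<beta> l w i \<noteq> 0" "\<And>j. \<beta> l v j = 0" and m: "\<beta> m v i' \<noteq> 0"
  shows "(\<exists>c. \<forall>j. \<beta> l y j = c * \<beta> m v j) \<and> (\<exists>c. \<forall>j. \<beta> m y j = c * \<beta> m v j)"
proof
  have M: "\<beta> m y j = \<beta> m y i' / \<beta> m v i' * \<beta> m v j" for y j
    using rank[of m v i' y j] m by (simp add: field_simps)
  then show "\<exists>c. \<forall>j. \<beta> m y j = c * \<beta> m v j" by blast
  \<comment> \<open>Since \<open>l\<close> kills \<open>v\<close>, row \<open>v\<close> of
    \<open>l + m\<close> is row \<open>v\<close> of \<open>m\<close>. All rows of
    \<open>l + m\<close> and of \<open>m\<close> are multiples of it, and subtraction gives the same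
    for the rows of \<open>l\<close>.\<close>
  have "(\<beta> l y j + \<beta> m y j) * \<beta> m v i' = (\<beta> l y i' + \<beta> m y i') * \<beta> m v j" for j
    using rank[of "l + m" v i' y j] by (simp add: add l(2) mult.commute)
  moreover have "\<beta> m y j * \<beta> m v i' = \<beta> m y i' * \<beta> m v j" for j
    using rank[of m v i' y j] by (simp add: mult.commute)
  ultimately have "\<beta> l y j * \<beta> m v i' = \<beta> l y i' * \<beta> m v j" for j
    by (simp add: distrib_right)
  then have "\<beta> l y j = \<beta> l y i' / \<beta> m v i' * \<beta> m v j" for j
    using m by (simp add: field_simps)
  then show "\<exists>c. \<forall>j. \<beta> l y j = c * \<beta> m v j" by blast
qed

text \<open>If a non-zero \<open>l\<close> kills some \<open>v\<close> that \<open>m\<close> does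
  not kill, \<open>rank_one_family_step\<close> makes \<open>\<beta> m v\<close> span all images.
  This is the classification of linear spaces of maps of rank at most one: a common image line or a
  common kernel.\<close>

lemma rank_one_family:
  fixes \<beta> :: "'v::plus \<Rightarrow> 'y \<Rightarrow> 'j \<Rightarrow> 'k::field"
  assumes add: "\<And>l m y j. \<beta> (l + m) y j = \<beta> l y j + \<beta> m y j"
    and rank: "\<And>l y z i j. \<beta> l y i * \<beta> l z j = \<beta> l y j * \<beta> l z i"
  obtains (image) u where "\<And>l y. \<exists>c. \<forall>j. \<beta> l y j = c * u j"
    | (kernel) "\<And>l m w i v j. \<beta> l w i \<noteq> 0 \<Longrightarrow> (\<And>j. \<beta> l v j = 0) \<Longrightarrow> \<beta> m v j = 0"
proof (cases "\<exists>l m w i v j. \<beta> l w i \<noteq> 0 \<and> (\<forall>j. \<beta> l v j = 0) \<and> \<beta> m v j \<noteq> 0")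
  case False
  then show ?thesis using kernel by blast
next
  case True
  then obtain l m w i v i' where l: "\<beta> l w i \<noteq> 0" "\<And>j. \<beta> l v j = 0" and m: "\<beta> m v i' \<noteq> 0"
    by blast
  note step = rank_one_family_step[of \<beta>, OF add rank]
  have "\<exists>c. \<forall>j. \<beta> p y j = c * \<beta> m v j" for p y
  proof (cases "\<exists>y j. \<beta> p y j \<noteq> 0")
    case False
    then show ?thesis by (intro exI[of _ 0]) auto
  next
    case True
    then obtain y0 i0 where p: "\<beta> p y0 i0 \<noteq> 0" by blast
    show ?thesis
    proof (cases "\<forall>j. \<beta> p v j = 0")
      case True
      then show ?thesis using step[OF p _ m, of y] by blast
    next
      case False
      \<comment> \<open>When \<open>p\<close> does not kill \<open>v\<close>, the step compares
        \<open>l\<close> with \<open>p\<close> and with \<open>m\<close>: the non-zero row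
        \<open>\<beta> l w\<close> is a multiple of both \<open>\<beta> p v\<close> and
        \<open>\<beta> m v\<close>, so these two span the same line.\<close>
      then obtain k where k: "\<beta> p v k \<noteq> 0" by blast
      obtain c where c: "\<And>j. \<beta> p y j = c * \<beta> p v j" using step[OF l k, of y] by blast
      obtain d where d: "\<And>j. \<beta> l w j = d * \<beta> p v j" using step[OF l k, of w] by blast
      obtain e where e: "\<And>j. \<beta> l w j = e * \<beta> m v j" using step[OF l m, of w] by blast
      have "d \<noteq> 0" using l(1) d by auto
      then have "\<beta> p y j = c * e / d * \<beta> m v j" for j
        using c[of j] d[of j] e[of j] by (simp add: field_simps)
      then show ?thesis by blast
    qed
  qed
  then show ?thesis using image by blast
qed

section \<open>Polynomial functions in coordinates\<close>

text \<open>The coordinate counterpart of \<open>polynomial_functions\<close>, for polynomials in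
  the coefficients of a linear form.\<close>

inductive_set coord_polys :: "('k::field^'n \<Rightarrow> 'k) set" where
  const: "(\<lambda>_. c) \<in> coord_polys"
| coord: "(\<lambda>l. l $ i) \<in> coord_polys"
| add: "p \<in> coord_polys \<Longrightarrow> q \<in> coord_polys \<Longrightarrow> (\<lambda>l. p l + q l) \<in> coord_polys"
| mult: "p \<in> coord_polys \<Longrightarrow> q \<in> coord_polys \<Longrightarrow> (\<lambda>l. p l * q l) \<in> coord_polys"

lemma coord_polys_diff:
  assumes "p \<in> coord_polys" "q \<in> coord_polys"
  shows "(\<lambda>l. p l - q l) \<in> coord_polys"
  using coord_polys.add[OF assms(1) coord_polys.mult[OF coord_polys.const[of "-1"] assms(2)]] by simp

lemmas coord_polys_intros = coord_polys.intros coord_polys_diff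

lemma coord_polys_dot: "(\<lambda>l. dot a l) \<in> coord_polys"
  unfolding dot_def by (intro coord_polys_intros)

lemma coord_polys_on_line:
  assumes "p \<in> coord_polys"
  shows "\<exists>q. \<forall>t. p (a + t *s b) = poly q t"
  using assms
proof induction
  case (const c)
  then show ?case by (intro exI[of _ "[:c:]"]) simp
next
  case (coord i)
  then show ?case by (intro exI[of _ "[:a$i, b$i:]"]) simp
next
  case (add p q)
  then obtain p' q' where "\<forall>t. p (a + t *s b) = poly p' t" "\<forall>t. q (a + t *s b) = poly q' t" by blast
  then show ?case by (intro exI[of _ "p' + q'"]) simp
next
  case (mult p q)
  then obtain p' q' where "\<forall>t. p (a + t *s b) = poly p' t" "\<forall>t. q (a + t *s b) = poly q' t" by blast
  then show ?case by (intro exI[of _ "p' * q'"]) simp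
qed

text \<open>Two non-empty basic open sets meet: on the line through \<open>a\<close> and
  \<open>b\<close> both functions become non-zero univariate polynomials, whose product is non-zero
  somewhere because the field is infinite.\<close>

lemma coord_polys_common_nonzero:
  fixes p q :: "'k::field_char_0^'n \<Rightarrow> 'k"
  assumes "p \<in> coord_polys" "q \<in> coord_polys" "p a \<noteq> 0" "q b \<noteq> 0"
  shows "\<exists>c. p c \<noteq> 0 \<and> q c \<noteq> 0"
proof -
  obtain p' q' where p': "\<forall>t. p (a + t *s (b - a)) = poly p' t"
    and q': "\<forall>t. q (a + t *s (b - a)) = poly q' t"
    using coord_polys_on_line assms(1,2) by metis
  have "poly p' 0 \<noteq> 0" using p'[rule_format, of 0] assms(3) by simp
  moreover have "poly q' 1 \<noteq> 0" using q'[rule_format, of 1] assms(4) by simp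
  ultimately have "p' * q' \<noteq> 0" by auto
  then obtain t where "poly (p' * q') t \<noteq> 0" using poly_all_0_iff_0 by blast
  then have "p (a + t *s (b - a)) \<noteq> 0 \<and> q (a + t *s (b - a)) \<noteq> 0" by (simp add: p' q')
  then show ?thesis by blast
qed

section \<open>Generic surjectivity and injectivity\<close>

text \<open>Otherwise all maps sending a pair \<open>y\<close> to the function
  \<open>\<beta> l y\<close> of \<open>h\<close> have rank at most one, and
  \<open>rank_one_family\<close> applies: a common image line contradicts \<open>nondeg\<close>, a
  common kernel contradicts \<open>indep\<close>.\<close>

lemma pencil_rank_two:
  fixes a b :: "'h \<Rightarrow> 'k::field^3"
  assumes nondeg: "\<And>l. (\<And>h. dot (a h) l = 0) \<Longrightarrow> (\<And>h. dot (b h) l = 0) \<Longrightarrow> l = 0"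
    and indep: "\<And>\<alpha> \<gamma>. (\<And>l h. \<alpha> * dot (a h) l + \<gamma> * dot (b h) l = 0) \<Longrightarrow> \<alpha> = 0 \<and> \<gamma> = 0"
  shows "\<exists>l h h'. dot (a h) l * dot (b h') l - dot (a h') l * dot (b h) l \<noteq> 0"
proof (rule ccontr)
  assume "\<not> ?thesis"
  then have minor: "dot (a h) l * dot (b h') l = dot (a h') l * dot (b h) l" for l h h' by simp
  define \<beta> where "\<beta> l y h = fst y * dot (a h) l + snd y * dot (b h) l" for l h and y :: "'k \<times> 'k"
  have add: "\<beta> (l + m) y h = \<beta> l y h + \<beta> m y h" for l m y h
    by (simp add: \<beta>_def algebra_simps)
  have rank: "\<beta> l y i * \<beta> l z j = \<beta> l y j * \<beta> l z i" for l y z i j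
  proof -
    have "\<beta> l y i * \<beta> l z j - \<beta> l y j * \<beta> l z i
      = (fst y * snd z - snd y * fst z) * (dot (a i) l * dot (b j) l - dot (a j) l * dot (b i) l)"
      by (simp add: \<beta>_def algebra_simps)
    then show ?thesis using minor[of i l j] by simp
  qed
  show False
  proof (cases rule: rank_one_family[of \<beta>, OF add rank, case_names image kernel])
    case (image u)
    have A: "\<exists>c. \<forall>h. dot (a h) l = c * u h" and B: "\<exists>c. \<forall>h. dot (b h) l = c * u h" for l
      using image[of l "(1, 0)"] image[of l "(0, 1)"] by (simp_all add: \<beta>_def)
    show False
    proof (cases "\<exists>h. u h \<noteq> 0")
      case False
      then have "(1::'k^3) = 0" using A B by (intro nondeg) (metis mult_zero_right)+
      then show False by (simp add: vec_eq_iff)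
    next
      case True
      then obtain h0 where h0: "u h0 \<noteq> 0" by blast
      \<comment> \<open>All the functions are multiples of \<open>u\<close>, so vanishing at the
        single \<open>h0\<close> already forces every value at \<open>x\<close> to vanish.\<close>
      obtain x where x: "x \<noteq> 0" "dot (a h0) x = 0" "dot (b h0) x = 0"
        using two_functionals_common_zero by blast
      have "x = 0"
        using A[of x] B[of x] h0 x by (intro nondeg) (metis mult_eq_0_iff)+
      then show False using x by simp
    qed
  next
    case kernel
    obtain l h0 where l: "dot (a h0) l \<noteq> 0 \<or> dot (b h0) l \<noteq> 0"
      using nondeg[of 1] by (metis one_index zero_index zero_neq_one)
    \<comment> \<open>This \<open>y\<close> is chosen to be killed at \<open>h0\<close>; as the 2 x
      2 minors vanish, it is then killed at every \<open>h\<close>.\<close>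
    define y where "y = (- dot (b h0) l, dot (a h0) l)"
    have "\<beta> l (1,0) h0 \<noteq> 0 \<or> \<beta> l (0,1) h0 \<noteq> 0" using l by (simp add: \<beta>_def)
    moreover have "\<beta> l y h = 0" for h using minor[of h0 l h] by (simp add: \<beta>_def y_def algebra_simps)
    ultimately have "\<beta> m y h = 0" for m h using kernel by blast
    then show False using indep[of "fst y" "snd y"] l by (auto simp: \<beta>_def y_def)
  qed
qed

text \<open>\<open>T\<close> models products of three linear forms in a level algebra of type two
  and socle degree three; the last argument names one of two coordinates of the socle. Equivalently,
  \<open>T\<close> polarizes a pair of ternary cubics. The transpositions in \<open>sym\<close>
  generate all permutations, so linearity in the first argument spreads to the other two.\<close>

locale cubic_pair =
  fixes T :: "'k::field_char_0^3 \<Rightarrow> 'k^3 \<Rightarrow> 'k^3 \<Rightarrow> bool \<Rightarrow> 'k"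
  assumes add: "T (l + l') m v s = T l m v s + T l' m v s"
    and scale: "T (c *s l) m v s = c * T l m v s"
    and sym: "T l m v s = T m l v s" "T l m v s = T l v m s"
    and nondegenerate: "(\<And>m v s. T l m v s = 0) \<Longrightarrow> l = 0"
begin

lemma linear [simp]:
  "T (l + l') m v s = T l m v s + T l' m v s"
  "T m (l + l') v s = T m l v s + T m l' v s"
  "T m v (l + l') s = T m v l s + T m v l' s"
  "T (c *s l) m v s = c * T l m v s"
  "T m (c *s l) v s = c * T m l v s"
  "T m v (c *s l) s = c * T m v l s"
  using add scale sym by metis+

lemma zero [simp]: "T 0 m v s = 0" "T l 0 v s = 0" "T l m 0 s = 0"
  using linear(4-6)[where c = 0 and l = 0] by simp_all

lemma rotate: "T l m v s = T m v l s" "T l m v s = T v l m s" "T l m v s = T v m l s"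
proof -
  show "T l m v s = T m v l s" by (rule trans[OF sym(1) sym(2)])
  show "T l m v s = T v l m s" by (rule trans[OF sym(2) sym(1)])
  then show "T l m v s = T v m l s" by (rule trans[OF _ sym(2)])
qed

text \<open>The rows of the matrix of the multiplication by \<open>l\<close>.\<close>

definition row :: "3 \<times> bool \<Rightarrow> 'k^3 \<Rightarrow> 'k^3" where
  "row j l = (\<chi> i. T l (axis i 1) (axis (fst j) 1) (snd j))"

lemma dot_row: "dot (row j l) m = T l m (axis (fst j) 1) (snd j)"
  by (subst (2) vec3_expand[of m]) (simp add: dot_def row_def mult.commute)

lemma row_add: "row j (l + l') = row j l + row j l'"
  by (simp add: row_def vec_eq_iff)

lemma row_scale: "row j (c *s l) = c *s row j l"
  by (simp add: row_def vec_eq_iff)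

lemma eq_0_if_rows:
  assumes "\<And>j. dot (row j l) m = 0"
  shows "T l m v s = 0"
proof -
  have "T l m (axis k 1) s = 0" for k
    using assms[of "(k, s)"] by (simp add: dot_row)
  then show ?thesis by (subst vec3_expand[of v]) simp
qed

lemma row_coord_polys: "(\<lambda>l. row j l $ i) \<in> coord_polys"
proof -
  have "(\<lambda>l. row j l $ i) = dot (\<chi> p. T (axis p 1) (axis i 1) (axis (fst j) 1) (snd j))"
  proof
    fix l
    show "row j l $ i = dot (\<chi> p. T (axis p 1) (axis i 1) (axis (fst j) 1) (snd j)) l"
      by (subst (1) vec3_expand[of l]) (simp add: dot_def row_def mult.commute)
  qed
  then show ?thesis using coord_polys_dot by simp
qed

text \<open>These are the 3 x 3 minors, written as triple products, of the 6 x 3 matrix with rows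
  \<open>row j l\<close>.\<close>

definition minor :: "3 \<times> bool \<Rightarrow> 3 \<times> bool \<Rightarrow> 3 \<times> bool \<Rightarrow> 'k^3 \<Rightarrow> 'k" where
  "minor i j k l = dot (cross (row i l) (row j l)) (row k l)"

lemma minor_coord_polys: "minor i j k \<in> coord_polys"
  unfolding minor_def dot_def cross_component
  by (intro coord_polys_intros row_coord_polys)

text \<open>By \<open>cramer_dual\<close>, the minor times \<open>m\<close> is a combination of
  vectors with coefficients of the form \<open>dot (row i l) m\<close>, and these vanish.\<close>

lemma injective_if_minor:
  assumes "minor i j k l \<noteq> 0" "\<And>v s. T l m v s = 0"
  shows "m = 0"
proof -
  have "dot (row i l) m = 0" for i using assms(2) by (simp add: dot_row)
  then have "minor i j k l *s m = 0"
    using cramer_dual[of "row i l" "row j l" "row k l" m] by (simp add: minor_def)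
  then show ?thesis using assms(1) by simp
qed

text \<open>Polarization: in characteristic zero, \<open>T\<close> would vanish identically if it
  vanished on all squares, against \<open>nondegenerate\<close>.\<close>

lemma square_nonzero: "\<exists>l v s. T l l v s \<noteq> 0"
proof (rule ccontr)
  assume "\<not> ?thesis"
  then have sq: "T l l v s = 0" for l v s by blast
  have "2 * T l m v s = T (l + m) (l + m) v s - T l l v s - T m m v s" for l m v s
    by (simp add: sym(1)[of m l])
  then have "T l m v s = 0" for l m v s by (simp add: sq)
  then have "(1::'k^3) = 0" using nondegenerate by blast
  then show False by (simp add: vec_eq_iff)
qed

text \<open>If every \<open>l\<close> had rank at most one, \<open>rank_one_family\<close> would
  leave two cases. With a common image line, a vector \<open>n\<close> killed by both halves of
  \<open>u\<close> annihilates everything by symmetry of \<open>T\<close>; with a common kernel, a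
  kernel vector \<open>y\<close> does. Both contradict \<open>nondegenerate\<close>.\<close>

lemma minors_rank_two:
  assumes minor: "\<And>i j k l. minor i j k l = 0"
  shows "\<exists>l i j. cross (row i l) (row j l) \<noteq> 0"
proof (rule ccontr)
  assume "\<not> ?thesis"
  then have cross0: "cross (row i l) (row j l) = 0" for i j l by blast
  define \<beta> where "\<beta> l y j = dot (row j l) y" for l y j
  have \<beta>_add: "\<beta> (l + m) y h = \<beta> l y h + \<beta> m y h" for l m y h
    by (simp add: \<beta>_def row_add)
  have rank: "\<beta> l y i * \<beta> l z j = \<beta> l y j * \<beta> l z i" for l y z i j
  proof -
    have "dot (row i l) y * dot (row j l) z - dot (row j l) y * dot (row i l) z
      = dot (cross (row i l) (row j l)) (cross y z)"
      by (simp add: dot_def algebra_simps)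
    also have "\<dots> = 0" by (simp add: cross0)
    finally show ?thesis by (simp add: \<beta>_def)
  qed
  show False
  proof (cases rule: rank_one_family[of \<beta>, OF \<beta>_add rank, case_names image kernel])
    case (image u)
    obtain n where n: "n \<noteq> 0" "dot (\<chi> k. u (k, True)) n = 0" "dot (\<chi> k. u (k, False)) n = 0"
      using two_functionals_common_zero by blast
    then have n': "dot (\<chi> k. u (k, s)) n = 0" for s by (cases s) auto
    have "T l y n s = 0" for l y s
    proof -
      obtain c where "\<And>j. \<beta> l y j = c * u j" using image by blast
      then have "T l y (axis k 1) s = c * u (k, s)" for k
        using dot_row[of "(k, s)" l y] by (simp add: \<beta>_def)
      then have "T l y n s = c * dot (\<chi> k. u (k, s)) n"
        by (subst vec3_expand[of n]) (simp add: dot_def algebra_simps)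
      then show ?thesis by (simp add: n')
    qed
    then have "T n l y s = 0" for l y s by (subst rotate(1))
    then have "n = 0" using nondegenerate by blast
    then show False using n by simp
  next
    case kernel
    obtain l v s where "T l l v s \<noteq> 0" using square_nonzero by blast
    then obtain j where j: "dot (row j l) l \<noteq> 0" using eq_0_if_rows by blast
    obtain y where y: "y \<noteq> 0" "dot (row j l) y = 0" using two_functionals_common_zero by blast
    have "row j l \<noteq> 0" using j by auto
    then have "\<beta> l y i = 0" for i
      using parallel_if_cross_eq_0[OF cross0[of j l i]] y by (auto simp: \<beta>_def)
    then have "dot (row i m) y = 0" for m i
      using kernel[of l l j y m i] j by (simp add: \<beta>_def)
    then have "T m y v s = 0" for m v s using eq_0_if_rows by blast
    then have "T y m v s = 0" for m v s by (subst sym(1))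
    then show False using nondegenerate y by blast
  qed
qed

text \<open>If all minors vanish, then the cross product of two rows is a kernel vector depending
  quadratically on \<open>l\<close>; moving \<open>l\<close> along a line shows that this vector has square zero.\<close>

lemma kernel_square_zero:
  assumes minor: "\<And>i j k l. minor i j k l = 0"
  defines "M \<equiv> \<lambda>i j l. cross (row i l) (row j l)"
  shows "T l (M i j l) v s = 0" and "T n (M i j l) (M i j l) s = 0"
proof -
  have ker: "T l (M i j l) v s = 0" for l v s
    using minor[of i j _ l] by (intro eq_0_if_rows) (simp add: M_def minor_def dot_commute)
  then show "T l (M i j l) v s = 0" .
  define M1 where "M1 = cross (row i l) (row j n) + cross (row i n) (row j l)"
  have M: "M i j (l + t *s n) = M i j l + t *s M1 + (t * t) *s M i j n" for t
    by (simp add: M_def M1_def row_add row_scale vec_eq_iff forall_3 algebra_simps)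
  let ?q = "\<lambda>m. T n m (M i j l) s"
  \<comment> \<open>Pairing the kernel relation at \<open>l + t *s n\<close> with the kernel vector
    at \<open>l\<close> removes the contribution of \<open>l\<close>. The remaining factor
    \<open>t\<close> can be cancelled only for \<open>t \<noteq> 0\<close>.\<close>
  have q: "?q (M i j l) + t * ?q M1 + t * t * ?q (M i j n) = 0" if "t \<noteq> 0" for t
  proof -
    have "0 = T (l + t *s n) (M i j (l + t *s n)) (M i j l) s" using ker by simp
    also have "\<dots> = T l (M i j (l + t *s n)) (M i j l) s + t * ?q (M i j (l + t *s n))" by simp
    also have "T l (M i j (l + t *s n)) (M i j l) s = 0" by (subst sym(2)) (rule ker)
    finally have "?q (M i j (l + t *s n)) = 0" using that by simp
    then show ?thesis by (simp only: M linear)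
  qed
  \<comment> \<open>Interpolation replaces the excluded value \<open>t = 0\<close>: a quadratic
    polynomial vanishing at 1, -1 and 2 has constant coefficient zero, as 3 is invertible.\<close>
  have lagrange: "3 * a = 3 * (a + b + c) + (a - b + c) - (a + 2 * b + 4 * c)" for a b c :: 'k
    by (simp add: algebra_simps)
  have "?q (M i j l) + ?q M1 + ?q (M i j n) = 0" using q[of 1] by simp
  moreover have "?q (M i j l) - ?q M1 + ?q (M i j n) = 0" using q[of "-1"] by simp
  moreover have "?q (M i j l) + 2 * ?q M1 + 4 * ?q (M i j n) = 0" using q[of 2] by simp
  ultimately have "3 * ?q (M i j l) = 3 * 0 + 0 - 0"
    by (simp only: lagrange[of "?q (M i j l)" "?q M1" "?q (M i j n)"])
  then show "?q (M i j l) = 0" by simp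
qed

text \<open>A non-zero cross product of two rows is a kernel vector. If there is none, all rows are
  multiples of one of them, and a non-zero vector killed by that row will do.\<close>

lemma kernel_vector:
  assumes minor: "\<And>i j k l. minor i j k l = 0"
  shows "\<exists>m. m \<noteq> 0 \<and> (\<forall>v s. T l m v s = 0)"
proof (cases "\<exists>i j. cross (row i l) (row j l) \<noteq> 0")
  case True
  then show ?thesis using kernel_square_zero(1)[OF minor] by blast
next
  case False
  then have cross0: "cross (row i l) (row j l) = 0" for i j by blast
  obtain i where i: "row i l \<noteq> 0 \<or> (\<forall>j. row j l = 0)" by blast
  obtain m where m: "m \<noteq> 0" "dot (row i l) m = 0" using two_functionals_common_zero by blast
  have "dot (row j l) m = 0" for j
  proof (cases "row i l = 0")
    case True
    then show ?thesis using i by (metis dot_linear(2))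
  next
    case False
    then show ?thesis using parallel_if_cross_eq_0[OF cross0[of i j]] m(2) by auto
  qed
  then show ?thesis using m(1) eq_0_if_rows by blast
qed

text \<open>If all minors vanished, a generic \<open>L\<close> would have kernel spanned by one
  vector \<open>M\<close>. For a third basis vector \<open>N\<close>, the kernels of
  \<open>L + N\<close> and \<open>L - N\<close> make the products \<open>LL\<close> and
  \<open>LN\<close> multiples of \<open>MN\<close>, and then a combination of \<open>L\<close> and
  \<open>N\<close> is a second kernel vector of \<open>L\<close>.\<close>

lemma exists_minor_nonzero: "\<exists>i j k l. minor i j k l \<noteq> 0"
proof (rule ccontr)
  assume "\<not> ?thesis"
  then have minor: "minor i j k l = 0" for i j k l by blast
  obtain l1 i j where l1: "cross (row i l1) (row j l1) \<noteq> 0" using minors_rank_two[OF minor] by blast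
  then obtain p where p: "cross (row i l1) (row j l1) $ p \<noteq> 0" by (metis vec_eq_iff zero_index)
  obtain l2 v s where l2: "T l2 l2 v s \<noteq> 0" using square_nonzero by blast
  then obtain q where q: "dot (row q l2) l2 \<noteq> 0" using eq_0_if_rows by blast
  have "(\<lambda>l. cross (row i l) (row j l) $ p) \<in> coord_polys"
    using exhaust_3[of p] by (auto intro!: coord_polys_intros row_coord_polys)
  moreover have "(\<lambda>l. dot (row q l) l) \<in> coord_polys"
    unfolding dot_def by (intro coord_polys_intros row_coord_polys)
  \<comment> \<open>Both conditions are open and non-empty, so one \<open>L\<close> has rank two and
    also does not annihilate itself.\<close>
  ultimately obtain L where L: "cross (row i L) (row j L) $ p \<noteq> 0" "dot (row q L) L \<noteq> 0"
    using coord_polys_common_nonzero[of "\<lambda>l. cross (row i l) (row j l) $ p" "\<lambda>l. dot (row q l) l"] p q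
    by blast
  define M where "M = cross (row i L) (row j L)"
  have M0: "M \<noteq> 0" using L(1) by (auto simp: M_def)
  have LM: "T L M v s = 0" and MM: "T n M M s = 0" for v s n
    using kernel_square_zero[OF minor] by (simp_all add: M_def)
  have ker_L: "\<exists>c. x = c *s M" if "\<And>v s. T L x v s = 0" for x
    unfolding M_def using that M0 by (intro kernel_of_two_functionals) (simp_all add: dot_row M_def)
  have LL: "\<exists>v s. T L L v s \<noteq> 0" using L(2) by (auto simp: dot_row)
  \<comment> \<open>\<open>L\<close> annihilates \<open>M\<close> but not itself, so the two are
    independent.\<close>
  have "cross L M \<noteq> 0"
  proof
    assume *: "cross L M = 0"
    have "L \<noteq> 0" using L(2) by auto
    then obtain c where c: "M = c *s L" using parallel_if_cross_eq_0[OF *] by blast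
    then have "c \<noteq> 0" using M0 by auto
    then show False using LL LM by (auto simp: c)
  qed
  then obtain N where N: "dot (cross L M) N \<noteq> 0" using dot_nondegenerate by blast
  have span: "\<exists>a b c. v = a *s L + b *s M + c *s N" for v
  proof -
    have "v = (1 / dot (cross L M) N) *s (dot (cross L M) N *s v)" using N by simp
    then show ?thesis unfolding cramer_span[of L M N v]
      by (simp only: vector_add_ldistrib vector_smult_assoc) blast
  qed
  have MNL: "T M N L s = 0" and MNM: "T M N M s = 0" for s
    using LM[of N s] MM[of N s] by (simp_all only: rotate(2)[of M N L] rotate(1)[of M N M])
  \<comment> \<open>\<open>T M\<close> vanishes on all other pairs of basis vectors, so it cannot
    vanish on \<open>N\<close>, \<open>N\<close> as well.\<close>
  have "\<exists>s. T M N N s \<noteq> 0"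
  proof (rule ccontr)
    assume "\<not> ?thesis"
    then have MNN: "T M N N s = 0" for s by blast
    have "T M x y s = 0" for x y s
    proof -
      obtain a b c a' b' c' where "x = a *s L + b *s M + c *s N" "y = a' *s L + b' *s M + c' *s N"
        using span by metis
      moreover have "T M L y s = 0" "T M M y s = 0" for y
        using LM[of y s] MM[of y s] by (simp_all only: sym(1)[of M L] rotate(2)[of M M y])
      ultimately show ?thesis by (simp add: MNN MNL MNM)
    qed
    then show False using nondegenerate M0 by blast
  qed
  then obtain \<sigma> where w: "T M N N \<sigma> \<noteq> 0" by blast
  \<comment> \<open>A kernel vector \<open>K\<close> of \<open>L + t *s N\<close> has no
    \<open>N\<close>-component, since pairing with \<open>M\<close> leaves only a multiple of
    \<open>T M N N \<sigma>\<close>. Its \<open>L\<close>-component \<open>x\<close> is non-zero,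
    and dividing by it gives the relation.\<close>
  have rel: "\<exists>c. \<forall>v s. T L L v s + t * T L N v s = c * T M N v s" if t: "t \<noteq> 0" for t
  proof -
    have "\<exists>K. K \<noteq> 0 \<and> (\<forall>v s. T (L + t *s N) K v s = 0)"
      by (rule kernel_vector[OF minor])
    then obtain K where K: "K \<noteq> 0" "\<And>v s. T (L + t *s N) K v s = 0" by blast
    obtain x y z where xyz: "K = x *s L + y *s M + z *s N" using span by blast
    have zeros: "T L L M \<sigma> = 0" "T L M M \<sigma> = 0" "T L N M \<sigma> = 0" "T N L M \<sigma> = 0" "T N M M \<sigma> = 0"
      using LM[of L \<sigma>] LM[of M \<sigma>] LM[of N \<sigma>] MM[of N \<sigma>]
      by (simp_all only: sym(2)[of L L M] sym(2)[of L N M] rotate(1)[of N L M])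
    have "T (L + t *s N) K M \<sigma> = t * (z * T N N M \<sigma>)" by (simp add: xyz zeros)
    then have "t * (z * T M N N \<sigma>) = 0" by (simp only: K(2) rotate(2)[of N N M])
    then have "z = 0" using t w by simp
    have "x * (T L L v s + t * T L N v s) + t * y * T M N v s = 0" for v s
      using K(2)[of v s] LM by (simp add: xyz \<open>z = 0\<close> sym(1)[of N L] sym(1)[of N M] algebra_simps)
    moreover have "x \<noteq> 0"
    proof
      assume "x = 0"
      then have "t * y * T M N N \<sigma> = 0" using calculation[of N \<sigma>] by simp
      then show False using K(1) t w by (simp add: xyz \<open>x = 0\<close> \<open>z = 0\<close>)
    qed
    moreover have "a = (- t * y / x) * b" if "x * a + t * y * b = 0" "x \<noteq> 0" for a b
    proof -
      have "x * a = - (t * y * b)" using that(1) by (simp add: eq_neg_iff_add_eq_0)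
      then have "x * a = x * ((- t * y / x) * b)" using that(2) by simp
      then show ?thesis using that(2) by (simp only: mult_cancel_left) blast
    qed
    ultimately have "T L L v s + t * T L N v s = (- t * y / x) * T M N v s" for v s
      by blast
    then show ?thesis by blast
  qed
  \<comment> \<open>For \<open>t = 1\<close> and \<open>t = -1\<close>, half the sum and half the
    difference of the relations isolate \<open>T L L\<close> and \<open>T L N\<close>.\<close>
  obtain c d where c: "\<And>v s. T L L v s + T L N v s = c * T M N v s"
    and d: "\<And>v s. T L L v s - T L N v s = d * T M N v s"
    using rel[of 1] rel[of "-1"] by auto
  define \<alpha> \<gamma> where "\<alpha> = (c + d) / 2" and "\<gamma> = (c - d) / 2"
  have half: "a = (r + q) / 2 * e" "b = (r - q) / 2 * e" if "a + b = r * e" "a - b = q * e"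
    for a b r q e :: 'k
  proof -
    have "2 * a = (r + q) * e" "2 * b = (r - q) * e"
      using that by (simp_all add: distrib_right left_diff_distrib flip: that)
    then show "a = (r + q) / 2 * e" "b = (r - q) / 2 * e" by (simp_all add: field_simps)
  qed
  have \<alpha>: "T L L v s = \<alpha> * T M N v s" and \<gamma>: "T L N v s = \<gamma> * T M N v s" for v s
    unfolding \<alpha>_def \<gamma>_def by (rule half[OF c d])+
  have "\<alpha> \<noteq> 0" using LL \<alpha> by auto
  \<comment> \<open>\<open>L\<close> annihilates \<open>X\<close>, but the
    \<open>N\<close>-component of \<open>X\<close> is \<open>- \<alpha>\<close>, so \<open>X\<close>
    is not a multiple of \<open>M\<close>.\<close>
  define X where "X = \<gamma> *s L + (- \<alpha>) *s N"
  have "T L X v s = 0" for v s unfolding X_def by (simp only: linear \<alpha> \<gamma>) (simp add: mult.left_commute)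
  then obtain e where "X = e *s M" using ker_L by blast
  then have "dot (cross L M) X = 0" by (simp add: dot_commute[of "cross L M" M])
  moreover have "dot (cross L M) X = - \<alpha> * dot (cross L M) N"
    unfolding X_def by (simp only: dot_linear dot_commute[of "cross L M" L] dot_cross_self) simp
  ultimately show False using N \<open>\<alpha> \<noteq> 0\<close> by simp
qed

end

section \<open>Homogeneous components\<close>

abbreviation pcarrier :: "nat \<Rightarrow> 'k::field mpoly set" where
  "pcarrier n \<equiv> carrier (polynomial_ring n)"

lemma polynomial_ring_ops [simp]:
  "monoid.mult (polynomial_ring n) = (*)" "add (polynomial_ring n) = (+)"
  "one (polynomial_ring n) = 1" "zero (polynomial_ring n) = 0"
  by (simp_all add: polynomial_ring_def)

lemma pcarrier_iff: "f \<in> pcarrier n \<longleftrightarrow> (\<forall>m\<in>Poly_Mapping.keys f. Poly_Mapping.keys m \<subseteq> {..<n})"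
  by (simp add: polynomial_ring_def)

lemma pcarrier_closed:
  fixes f g :: "'k::field mpoly"
  shows "(0 :: 'k mpoly) \<in> pcarrier n" and "f \<in> pcarrier n \<Longrightarrow> g \<in> pcarrier n \<Longrightarrow> f + g \<in> pcarrier n"
    and "f \<in> pcarrier n \<Longrightarrow> g \<in> pcarrier n \<Longrightarrow> f * g \<in> pcarrier n"
proof -
  interpret cring "polynomial_ring n :: 'k mpoly ring" by (rule polynomial_ring_cring)
  show "(0 :: 'k mpoly) \<in> pcarrier n" using zero_closed by simp
  show "f + g \<in> pcarrier n" if "f \<in> pcarrier n" "g \<in> pcarrier n" using a_closed[OF that] by simp
  show "f * g \<in> pcarrier n" if "f \<in> pcarrier n" "g \<in> pcarrier n" using m_closed[OF that] by simp
qed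

lemma polynomial_ring_minus [simp]:
  fixes f g :: "'k::field mpoly"
  assumes "f \<in> pcarrier n" "g \<in> pcarrier n"
  shows "f \<ominus>\<^bsub>polynomial_ring n\<^esub> g = f - g"
proof -
  interpret cring "polynomial_ring n :: 'k mpoly ring" by (rule polynomial_ring_cring)
  have "(f \<ominus>\<^bsub>polynomial_ring n\<^esub> g) \<oplus>\<^bsub>polynomial_ring n\<^esub> g = f"
    using assms by algebra
  then show ?thesis by (simp add: eq_diff_eq)
qed

abbreviation const :: "'k::field \<Rightarrow> 'k mpoly" where
  "const c \<equiv> Poly_Mapping.single 0 c"

lemma const_mult: "const (a * b) = const a * const b"
  by (simp add: mult_single)

lemma lookup_const_mult [simp]: "Poly_Mapping.lookup (const c * f) m = c * Poly_Mapping.lookup f m"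
  by (simp flip: mult_map_scale_conv_mult add: map.rep_eq when_def)

lemma total_degree_eq_sum:
  assumes "finite A" "Poly_Mapping.keys m \<subseteq> A"
  shows "total_degree m = (\<Sum>i\<in>A. Poly_Mapping.lookup m i)"
  unfolding total_degree_def using assms by (intro sum.mono_neutral_left) (auto simp: in_keys_iff)

lemma total_degree_add [simp]: "total_degree (a + b) = total_degree a + total_degree b"
proof -
  let ?A = "Poly_Mapping.keys a \<union> Poly_Mapping.keys b"
  have "finite ?A" by simp
  moreover have "Poly_Mapping.keys (a + b) \<subseteq> ?A" by (rule Poly_Mapping.keys_add)
  ultimately show ?thesis
    by (simp add: total_degree_eq_sum[of ?A] lookup_add sum.distrib)
qed

lemma total_degree_single [simp]: "total_degree (Poly_Mapping.single i d) = d"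
  by (simp add: total_degree_def)

lemma total_degree_0 [simp]: "total_degree 0 = 0"
  by (simp add: total_degree_def)

lemma total_degree_eq_0: "total_degree m = 0 \<longleftrightarrow> m = 0"
  by (auto simp: total_degree_def in_keys_iff intro!: poly_mapping_eqI)

lemma forms_iff:
  "f \<in> forms n d \<longleftrightarrow> f \<in> pcarrier n \<and> (\<forall>m\<in>Poly_Mapping.keys f. total_degree m = d)"
  by (simp add: forms_def)

lemma forms_pcarrier: "f \<in> forms n d \<Longrightarrow> f \<in> pcarrier n"
  by (simp add: forms_def)

lemma forms_0 [simp]: "0 \<in> forms n d"
  by (simp add: forms_iff pcarrier_iff)

lemma forms_add: "f \<in> forms n d \<Longrightarrow> g \<in> forms n d \<Longrightarrow> f + g \<in> forms n d"
  unfolding forms_iff using pcarrier_closed(2) Poly_Mapping.keys_add[of f g] by blast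

lemma forms_mult: "f \<in> forms n d \<Longrightarrow> g \<in> forms n e \<Longrightarrow> f * g \<in> forms n (d + e)"
  unfolding forms_iff using pcarrier_closed(3) keys_mult[of f g] by fastforce

lemma forms_const [simp]: "const c \<in> forms n 0"
  by (simp add: forms_iff pcarrier_iff)

lemma const_pcarrier [simp, intro]: "const c \<in> pcarrier n"
  by (simp add: pcarrier_iff)

lemma forms_const_mult: "f \<in> forms n d \<Longrightarrow> const c * f \<in> forms n d"
  using forms_mult[OF forms_const] by simp

lemma forms_diff:
  assumes "f \<in> forms n d" "g \<in> forms n d"
  shows "f - g \<in> forms n d"
proof -
  have "f + const (-1) * g \<in> forms n d" using assms by (intro forms_add forms_const_mult)
  also have "const (-1) * g = - g" by (rule poly_mapping_eqI) simp
  finally show ?thesis by simp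
qed

lemma forms_degree_0:
  assumes "f \<in> forms n 0" shows "f = const (Poly_Mapping.lookup f 0)"
proof (rule poly_mapping_eqI)
  fix m
  show "Poly_Mapping.lookup f m = Poly_Mapping.lookup (const (Poly_Mapping.lookup f 0)) m"
    using assms total_degree_eq_0[of m] not_in_keys_iff_lookup_eq_zero[of m f]
    by (cases "m = 0") (auto simp: forms_iff lookup_single when_def simp del: not_in_keys_iff_lookup_eq_zero)
qed

definition hcomp :: "nat \<Rightarrow> 'k::field mpoly \<Rightarrow> 'k mpoly" where
  "hcomp d f = Poly_Mapping.mapp (\<lambda>m c. c when total_degree m = d) f"

lemma lookup_hcomp [simp]:
  "Poly_Mapping.lookup (hcomp d f) m = (Poly_Mapping.lookup f m when total_degree m = d)"
  by (simp add: hcomp_def lookup_mapp when_def in_keys_iff)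

lemma hcomp_forms:
  assumes "f \<in> pcarrier n" shows "hcomp d f \<in> forms n d"
  using assms by (auto simp: forms_iff pcarrier_iff in_keys_iff when_def split: if_splits)

lemma hcomp_add: "hcomp d (f + g) = hcomp d f + hcomp d g"
  by (rule poly_mapping_eqI) (simp add: lookup_add when_def)

lemma hcomp_0 [simp]: "hcomp d 0 = 0"
  by (rule poly_mapping_eqI) simp

lemma hcomp_diff: "hcomp d (f - g) = hcomp d f - hcomp d g"
  by (rule poly_mapping_eqI) (simp add: lookup_minus when_def)

lemma hcomp_of_form: "f \<in> forms n e \<Longrightarrow> hcomp d f = (if d = e then f else 0)"
  by (rule poly_mapping_eqI) (auto simp: when_def forms_iff in_keys_iff)

lemma hcomp_sum: "hcomp d (sum f A) = (\<Sum>a\<in>A. hcomp d (f a))"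
  by (induction A rule: infinite_finite_induct) (simp_all add: hcomp_add)

lemma sum_hcomp:
  obtains N where "f = (\<Sum>d\<le>N. hcomp d f)"
proof
  define N where "N = Max (insert 0 (total_degree ` Poly_Mapping.keys f))"
  show "f = (\<Sum>d\<le>N. hcomp d f)"
  proof (rule poly_mapping_eqI)
    fix m
    show "Poly_Mapping.lookup f m = Poly_Mapping.lookup (\<Sum>d\<le>N. hcomp d f) m"
    proof (cases "m \<in> Poly_Mapping.keys f")
      case True
      then have "total_degree m \<le> N" unfolding N_def by (intro Max_ge) auto
      then show ?thesis by (simp add: lookup_sum when_def)
    qed (simp add: lookup_sum in_keys_iff)
  qed
qed

lemma poly_eq_sum_monomials:
  "f = (\<Sum>m\<in>Poly_Mapping.keys f. Poly_Mapping.single m (Poly_Mapping.lookup f m))"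
  by (rule poly_mapping_eqI) (simp add: lookup_sum lookup_single when_def in_keys_iff)

lemma monomial_induct [consumes 1, case_names zero add monomial]:
  fixes f :: "'k::field mpoly"
  assumes "f \<in> pcarrier n" and "Q 0" and add: "\<And>f g. Q f \<Longrightarrow> Q g \<Longrightarrow> Q (f + g)"
    and monomial: "\<And>m c. m \<in> Poly_Mapping.keys f \<Longrightarrow> Q (Poly_Mapping.single m c)"
  shows "Q f"
proof -
  have "Q (\<Sum>m\<in>A. Poly_Mapping.single m (Poly_Mapping.lookup f m))"
    if "finite A" "A \<subseteq> Poly_Mapping.keys f" for A
    using that by (induction A rule: finite_induct) (auto simp: assms(2) intro!: add monomial)
  from this[of "Poly_Mapping.keys f"] show ?thesis by (simp flip: poly_eq_sum_monomials)
qed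

text \<open>A monomial of positive degree is a variable occurring in it times a monomial of degree
  one less, so products of a linear form with a form of degree \<open>d\<close> span the forms of
  degree \<open>Suc d\<close>.\<close>

lemma forms_Suc_induct [consumes 1, case_names zero add mult]:
  fixes f :: "'k::field mpoly"
  assumes "f \<in> forms n (Suc d)" and "Q 0" and "\<And>f g. Q f \<Longrightarrow> Q g \<Longrightarrow> Q (f + g)"
    and mult: "\<And>f g. f \<in> forms n 1 \<Longrightarrow> g \<in> forms n d \<Longrightarrow> Q (f * g)"
  shows "Q f"
proof (rule monomial_induct[of f n])
  show "f \<in> pcarrier n" using assms(1) by (rule forms_pcarrier)
  show "Q (Poly_Mapping.single m c)" if m: "m \<in> Poly_Mapping.keys f" for m c
  proof -
    have deg: "total_degree m = Suc d" and vars: "Poly_Mapping.keys m \<subseteq> {..<n}"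
      using assms(1) m by (auto simp: forms_iff pcarrier_iff)
    then have "m \<noteq> 0" by auto
    then obtain i where i: "i \<in> Poly_Mapping.keys m" by (metis all_not_in_conv keys_eq_empty)
    define m' where "m' = m - Poly_Mapping.single i 1"
    have split: "m = Poly_Mapping.single i 1 + m'"
      using i by (intro poly_mapping_eqI)
        (auto simp: m'_def lookup_add lookup_minus lookup_single when_def in_keys_iff)
    have "total_degree m' = d" using deg unfolding split by simp
    moreover have "Poly_Mapping.keys m' \<subseteq> {..<n}"
    proof -
      have "Poly_Mapping.keys m' \<subseteq> Poly_Mapping.keys m"
        by (auto simp: m'_def in_keys_iff lookup_minus)
      then show ?thesis using vars by blast
    qed
    ultimately have "Poly_Mapping.single m' c \<in> forms n d"
      by (auto simp: forms_iff pcarrier_iff)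
    moreover have "Poly_Mapping.single (Poly_Mapping.single i 1) 1 \<in> (forms n 1 :: 'k mpoly set)"
      using i vars by (auto simp: forms_iff pcarrier_iff)
    ultimately have "Q (Poly_Mapping.single (Poly_Mapping.single i 1) 1 * Poly_Mapping.single m' c)"
      by (intro mult)
    then show ?thesis by (simp add: mult_single split)
  qed
qed (use assms in auto)

section \<open>Graded quotients\<close>

text \<open>Homogeneity is expressed through components instead of generators;
  \<open>graded_quotient_if_homogeneous\<close> and \<open>homogeneous_ideal\<close> translate
  between the two.\<close>

locale graded_quotient =
  fixes n :: nat and I :: "'k::field mpoly set"
  assumes ideal: "ideal I (polynomial_ring n)"
    and homogeneous: "f \<in> I \<Longrightarrow> hcomp d f \<in> I"
begin

abbreviation A where "A \<equiv> polynomial_ring n Quot I"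
abbreviation gr where "gr \<equiv> quotient_grading n I"
abbreviation cls where "cls \<equiv> a_r_coset (polynomial_ring n) I"

sublocale R: cring "polynomial_ring n :: 'k mpoly ring" by (rule polynomial_ring_cring)
sublocale I: ideal I "polynomial_ring n" by (rule ideal)
sublocale A: cring A using I.quotient_is_cring polynomial_ring_cring by blast

lemma ideal_pcarrier: "f \<in> I \<Longrightarrow> f \<in> pcarrier n"
  using I.a_Hcarr by simp

lemma ideal_0 [simp]: "0 \<in> I"
  using I.zero_closed by simp

lemma ideal_add: "f \<in> I \<Longrightarrow> g \<in> I \<Longrightarrow> f + g \<in> I"
  using I.a_closed by simp

lemma ideal_mult: "f \<in> I \<Longrightarrow> g \<in> pcarrier n \<Longrightarrow> g * f \<in> I" "f \<in> I \<Longrightarrow> g \<in> pcarrier n \<Longrightarrow> f * g \<in> I"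
  using I.I_l_closed I.I_r_closed by simp_all

lemma ideal_const_mult: "f \<in> I \<Longrightarrow> const c * f \<in> I"
  using ideal_mult(1) const_pcarrier by blast

lemma const_cancel: "c \<noteq> 0 \<Longrightarrow> const (1 / c) * (const c * f) = f"
  by (rule poly_mapping_eqI) simp

lemma ideal_const_mult_iff: "c \<noteq> 0 \<Longrightarrow> const c * f \<in> I \<longleftrightarrow> f \<in> I"
  using ideal_const_mult[of f c] ideal_const_mult[of "const c * f" "1 / c"] const_cancel[of c f]
  by metis

lemma ideal_uminus: "f \<in> I \<Longrightarrow> - f \<in> I"
  using ideal_const_mult[of f "-1"] by (simp add: single_uminus)

lemma ideal_diff: "f \<in> I \<Longrightarrow> g \<in> I \<Longrightarrow> f - g \<in> I"
  using ideal_add[of f "- g"] ideal_uminus by simp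

lemma ideal_sum: "(\<And>a. a \<in> B \<Longrightarrow> f a \<in> I) \<Longrightarrow> sum f B \<in> I"
  by (induction B rule: infinite_finite_induct) (auto simp: ideal_add)

lemma ideal_cong: "f - g \<in> I \<Longrightarrow> f \<in> I \<longleftrightarrow> g \<in> I"
  using ideal_add[of "f - g" g] ideal_diff[of f "f - g"] by auto

lemma cls_eq_iff: "f \<in> pcarrier n \<Longrightarrow> g \<in> pcarrier n \<Longrightarrow> cls f = cls g \<longleftrightarrow> f - g \<in> I"
  using R.quotient_eq_iff_same_a_r_cos[OF ideal, of f g] by simp

lemma A_carrier: "carrier A = cls ` pcarrier n"
  by (auto simp: FactRing_def A_RCOSETS_def RCOSETS_def a_r_coset_def)

lemma cls_closed: "f \<in> pcarrier n \<Longrightarrow> cls f \<in> carrier A"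
  by (simp add: A_carrier)

lemma A_mult [simp]: "f \<in> pcarrier n \<Longrightarrow> g \<in> pcarrier n \<Longrightarrow> cls f \<otimes>\<^bsub>A\<^esub> cls g = cls (f * g)"
  using I.rcoset_mult_add[of f g] by (simp add: FactRing_def)

lemma A_add [simp]: "f \<in> pcarrier n \<Longrightarrow> g \<in> pcarrier n \<Longrightarrow> cls f \<oplus>\<^bsub>A\<^esub> cls g = cls (f + g)"
  using I.a_rcos_sum[of f g] by (simp add: FactRing_def)

lemma A_zero: "\<zero>\<^bsub>A\<^esub> = cls 0"
proof -
  have "cls 0 = I" using I.a_rcos_const[of 0] by simp
  then show ?thesis by (simp add: FactRing_def)
qed

lemma cls_eq_zero_iff: "f \<in> pcarrier n \<Longrightarrow> cls f = \<zero>\<^bsub>A\<^esub> \<longleftrightarrow> f \<in> I"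
  using cls_eq_iff[of f 0] pcarrier_closed(1) by (simp add: A_zero)

lemma gr_def: "gr d = cls ` forms n d"
  by (simp add: quotient_grading_def)

lemma gr_0: "gr 0 = range (\<lambda>c. cls (const c))"
proof -
  have "forms n 0 = range (const :: 'k \<Rightarrow> 'k mpoly)" using forms_degree_0 forms_const by blast
  then show ?thesis by (simp add: gr_def image_image)
qed

lemma gr_eq_zero_iff: "gr d = {\<zero>\<^bsub>A\<^esub>} \<longleftrightarrow> forms n d \<subseteq> I"
proof
  show "forms n d \<subseteq> I" if "gr d = {\<zero>\<^bsub>A\<^esub>}"
  proof
    fix f assume f: "f \<in> (forms n d :: 'k mpoly set)"
    then have "cls f \<in> gr d" by (simp add: gr_def)
    then show "f \<in> I" using that cls_eq_zero_iff[OF forms_pcarrier[OF f]] by simp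
  qed
  show "gr d = {\<zero>\<^bsub>A\<^esub>}" if "forms n d \<subseteq> I"
  proof -
    have "gr d \<subseteq> {\<zero>\<^bsub>A\<^esub>}"
      using that cls_eq_zero_iff[OF forms_pcarrier] by (auto simp: gr_def)
    moreover have "\<zero>\<^bsub>A\<^esub> \<in> gr d" unfolding A_zero gr_def by (rule imageI) simp
    ultimately show ?thesis by blast
  qed
qed

definition lin :: "(nat \<Rightarrow> 'k mpoly) \<Rightarrow> nat \<Rightarrow> (nat \<Rightarrow> 'k) \<Rightarrow> 'k mpoly" where
  "lin v r c = (\<Sum>i<r. const (c i) * v i)"

lemma lin_closed: "(\<And>i. i < r \<Longrightarrow> v i \<in> pcarrier n) \<Longrightarrow> lin v r c \<in> pcarrier n"
  unfolding lin_def
  by (induction r) (auto intro!: pcarrier_closed(2,3) const_pcarrier pcarrier_closed(1))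

lemma lin_diff: "lin v r c - lin v r d = lin v r (\<lambda>i. c i - d i)"
  by (simp add: lin_def single_diff left_diff_distrib sum_subtractf)

lemma lin_cong: "(\<And>i. i < r \<Longrightarrow> c i = d i) \<Longrightarrow> lin v r c = lin v r d"
  by (simp add: lin_def)

text \<open>\<open>A.dimension\<close> is built from successive line extensions. Each contributes
  one representative, and its lying outside the previous space yields independence modulo
  \<open>I\<close>.\<close>

lemma dimension_obtain:
  assumes "A.dimension r (gr 0) E"
  shows "\<exists>v. (\<forall>i<r. v i \<in> pcarrier n) \<and> E = range (\<lambda>c. cls (lin v r c)) \<and>
    (\<forall>c. lin v r c \<in> I \<longrightarrow> (\<forall>i<r. c i = 0))"
  using assms
proof (induction r arbitrary: E)
  case 0
  then have "E = {\<zero>\<^bsub>A\<^esub>}" by (cases rule: A.dimension.cases)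
  then have "E = range (\<lambda>c. cls (lin (\<lambda>_. 0) 0 c))" by (simp add: lin_def A_zero image_constant_conv)
  then show ?case by (intro exI[of _ "\<lambda>_. 0"] conjI) simp_all
next
  case (Suc r)
  obtain a E' where a: "a \<in> carrier A" "a \<notin> E'" and E': "A.dimension r (gr 0) E'"
    and E: "E = A.line_extension (gr 0) a E'"
    using Suc.prems by (cases rule: A.dimension.cases) auto
  obtain v where v: "\<forall>i<r. v i \<in> pcarrier n" "E' = range (\<lambda>c. cls (lin v r c))"
    "\<forall>c. lin v r c \<in> I \<longrightarrow> (\<forall>i<r. c i = 0)"
    using Suc.IH[OF E'] by blast
  obtain w where w: "w \<in> pcarrier n" "a = cls w" using a(1) A_carrier by auto
  define v' where "v' = v(r := w)"
  have v': "\<forall>i<Suc r. v' i \<in> pcarrier n" using v(1) w(1) by (simp add: v'_def less_Suc_eq)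
  have lin: "lin v' (Suc r) c = const (c r) * w + lin v r c" for c
    by (simp add: lin_def v'_def add.commute)
  have closed: "const c * w \<in> pcarrier n" "lin v r d \<in> pcarrier n" for c d
    using v(1) w(1) by (auto intro!: pcarrier_closed(3) const_pcarrier lin_closed)
  have "E = range (\<lambda>c. cls (lin v' (Suc r) c))"
  proof
    show "E \<subseteq> range (\<lambda>c. cls (lin v' (Suc r) c))"
    proof
      fix x assume "x \<in> E"
      then obtain k c where "x = cls (const k) \<otimes>\<^bsub>A\<^esub> a \<oplus>\<^bsub>A\<^esub> cls (lin v r c)"
        unfolding E A.line_extension_mem_iff gr_0 v(2) by blast
      also have "\<dots> = cls (lin v' (Suc r) (c(r := k)))"
        using w closed
        by (simp add: lin lin_cong[of r "c(r := k)" c])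
      finally show "x \<in> range (\<lambda>c. cls (lin v' (Suc r) c))" by blast
    qed
    show "range (\<lambda>c. cls (lin v' (Suc r) c)) \<subseteq> E"
    proof clarify
      fix c
      have "cls (lin v' (Suc r) c) = cls (const (c r)) \<otimes>\<^bsub>A\<^esub> a \<oplus>\<^bsub>A\<^esub> cls (lin v r c)"
        using w closed by (simp add: lin)
      then show "cls (lin v' (Suc r) c) \<in> E"
        unfolding E A.line_extension_mem_iff gr_0 v(2) by blast
    qed
  qed
  moreover have "\<forall>i<Suc r. c i = 0" if I: "lin v' (Suc r) c \<in> I" for c
  proof -
    have "c r = 0"
    proof (rule ccontr)
      assume cr: "c r \<noteq> 0"
      have "const (1 / c r) * lin v' (Suc r) c = (const (1 / c r) * const (c r)) * w
        + (\<Sum>i<r. (const (1 / c r) * const (c i)) * v i)"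
        unfolding lin by (simp only: lin_def distrib_left sum_distrib_left mult.assoc)
      also have "\<dots> = w - lin v r (\<lambda>i. - c i / c r)"
        using cr by (simp add: mult_single lin_def single_uminus sum_negf)
      finally have "const (1 / c r) * lin v' (Suc r) c = w - lin v r (\<lambda>i. - c i / c r)" .
      then have "w - lin v r (\<lambda>i. - c i / c r) \<in> I" using ideal_const_mult[OF I] by metis
      then have "a \<in> E'" using cls_eq_iff w closed v(2) by auto
      then show False using a by blast
    qed
    then have "lin v r c \<in> I" using I by (simp add: lin)
    then show ?thesis using v(3) \<open>c r = 0\<close> by (auto simp: less_Suc_eq)
  qed
  ultimately show ?case using v' by blast
qed

lemma dimension_intro:
  assumes "\<And>i. i < r \<Longrightarrow> v i \<in> pcarrier n"
    and "\<And>c. lin v r c \<in> I \<Longrightarrow> \<forall>i<r. c i = 0"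
  shows "A.dimension r (gr 0) (range (\<lambda>c. cls (lin v r c)))"
  using assms
proof (induction r)
  case 0
  have "range (\<lambda>c. cls (lin v 0 c)) = {\<zero>\<^bsub>A\<^esub>}" by (simp add: lin_def A_zero image_constant_conv)
  then show ?case by (simp add: A.zero_dim)
next
  case (Suc r)
  let ?E = "\<lambda>r. range (\<lambda>c. cls (lin v r c))"
  have lin: "lin v (Suc r) c = const (c r) * v r + lin v r c" for c
    by (simp add: lin_def add.commute)
  have closed: "const c * v r \<in> pcarrier n" "lin v r d \<in> pcarrier n" "v r \<in> pcarrier n" for c d
    using Suc.prems(1) by (auto intro!: pcarrier_closed(3) const_pcarrier lin_closed)
  have IH: "A.dimension r (gr 0) (?E r)"
  proof (rule Suc.IH)
    fix c assume I: "lin v r c \<in> I"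
    have "lin v (Suc r) (c(r := 0)) = lin v r c"
      by (simp add: lin lin_cong[of r "c(r := 0)" c])
    then have "\<forall>i<Suc r. (c(r := 0)) i = 0" using Suc.prems(2) I by metis
    then show "\<forall>i<r. c i = 0" by (metis fun_upd_apply less_Suc_eq nat_neq_iff)
  qed (use Suc.prems(1) in auto)
  have "cls (v r) \<notin> ?E r"
  proof
    assume "cls (v r) \<in> ?E r"
    then obtain c where "v r - lin v r c \<in> I" using cls_eq_iff closed by blast
    \<comment> \<open>A class in the span of the earlier ones would be a relation with coefficient 1
      at index \<open>r\<close>.\<close>
    moreover have "lin v (Suc r) ((\<lambda>i. - c i)(r := 1)) = v r - lin v r c"
      unfolding lin by (simp add: lin_cong[of r "(\<lambda>i. - c i)(r := 1)" "\<lambda>i. - c i"])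
        (simp add: lin_def single_uminus sum_negf)
    ultimately have "\<forall>i<Suc r. ((\<lambda>i. - c i)(r := 1)) i = 0" using Suc.prems(2) by metis
    then show False by (auto dest: spec[of _ r])
  qed
  with cls_closed[OF closed(3)] have "A.dimension (Suc r) (gr 0) (A.line_extension (gr 0) (cls (v r)) (?E r))"
    using IH by (intro A.Suc_dim)
  also have "A.line_extension (gr 0) (cls (v r)) (?E r) = ?E (Suc r)"
  proof (intro equalityI subsetI)
    fix x assume "x \<in> A.line_extension (gr 0) (cls (v r)) (?E r)"
    then obtain k c where "x = cls (const k) \<otimes>\<^bsub>A\<^esub> cls (v r) \<oplus>\<^bsub>A\<^esub> cls (lin v r c)"
      unfolding A.line_extension_mem_iff gr_0 by blast
    also have "\<dots> = cls (lin v (Suc r) (c(r := k)))"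
      using closed by (simp add: lin lin_cong[of r "c(r := k)" c])
    finally show "x \<in> ?E (Suc r)" by blast
  next
    fix x assume "x \<in> ?E (Suc r)"
    then obtain c where "x = cls (lin v (Suc r) c)" by blast
    then have "x = cls (const (c r)) \<otimes>\<^bsub>A\<^esub> cls (v r) \<oplus>\<^bsub>A\<^esub> cls (lin v r c)"
      using closed by (simp add: lin)
    then show "x \<in> A.line_extension (gr 0) (cls (v r)) (?E r)"
      unfolding A.line_extension_mem_iff gr_0 by blast
  qed
  finally show ?case .
qed

end

text \<open>The polynomials all of whose components lie in \<open>I\<close> form an ideal
  \<open>J\<close>; it contains the homogeneous generators and hence all of
  \<open>I\<close>.\<close>

lemma graded_quotient_if_homogeneous:
  fixes I :: "'k::field mpoly set"
  assumes "homogeneous_ideal n I"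
  shows "graded_quotient n I"
proof -
  interpret R: cring "polynomial_ring n :: 'k mpoly ring" by (rule polynomial_ring_cring)
  obtain H where H: "H \<subseteq> (\<Union>d. forms n d)" and I: "I = Idl\<^bsub>polynomial_ring n\<^esub> H"
    using assms unfolding homogeneous_ideal_def by blast
  have Hc: "H \<subseteq> pcarrier n" using H forms_pcarrier by blast
  have ideal: "ideal I (polynomial_ring n)" unfolding I by (rule R.genideal_ideal[OF Hc])
  interpret I: ideal I "polynomial_ring n" by (rule ideal)
  define J where "J = {f \<in> pcarrier n. \<forall>d. hcomp d f \<in> I}"
  have I0: "0 \<in> I" using I.zero_closed by simp
  have Iadd: "f + g \<in> I" if "f \<in> I" "g \<in> I" for f g using I.a_closed that by simp
  have Isum: "sum f B \<in> I" if "\<And>b. b \<in> B \<Longrightarrow> f b \<in> I" for f and B :: "nat set"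
    using that by (induction B rule: infinite_finite_induct) (auto intro: I0 Iadd)
  have mult: "g * f \<in> J" if f: "f \<in> J" and g: "g \<in> pcarrier n" for f g
  proof -
    obtain N where N: "f = (\<Sum>e\<le>N. hcomp e f)" by (rule sum_hcomp)
    obtain M where M: "g = (\<Sum>e\<le>M. hcomp e g)" by (rule sum_hcomp)
    have fc: "f \<in> pcarrier n" and fI: "\<And>e. hcomp e f \<in> I" using f by (auto simp: J_def)
    have "hcomp d (g * f) \<in> I" for d
    proof -
      have "g * f = (\<Sum>a\<le>M. \<Sum>b\<le>N. hcomp a g * hcomp b f)"
        by (subst M, subst N) (rule sum_product)
      then have "hcomp d (g * f) = (\<Sum>a\<le>M. \<Sum>b\<le>N. hcomp d (hcomp a g * hcomp b f))"
        by (simp add: hcomp_sum)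
      also have "\<dots> \<in> I"
      proof (intro Isum)
        fix a b
        have "hcomp a g * hcomp b f \<in> I"
          using I.I_l_closed[OF fI[of b] forms_pcarrier[OF hcomp_forms[OF g]]] by simp
        then show "hcomp d (hcomp a g * hcomp b f) \<in> I"
          using I0 hcomp_of_form[OF forms_mult[OF hcomp_forms[OF g] hcomp_forms[OF fc]]] by simp
      qed
      finally show ?thesis .
    qed
    then show ?thesis using g fc by (simp add: J_def pcarrier_closed)
  qed
  have "ideal J (polynomial_ring n)"
  proof (rule idealI)
    show "ring (polynomial_ring n :: 'k mpoly ring)" by (rule R.ring_axioms)
    show "subgroup J (add_monoid (polynomial_ring n))"
    proof (rule R.add.subgroupI)
      show "J \<subseteq> pcarrier n" by (auto simp: J_def)
      show "J \<noteq> {}" using I0 pcarrier_closed(1) by (auto simp: J_def)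
      show "\<ominus>\<^bsub>polynomial_ring n\<^esub> a \<in> J" if a: "a \<in> J" for a
      proof -
        have ac: "a \<in> pcarrier n" using a by (simp add: J_def)
        have "const (-1) * a \<in> J" by (rule mult[OF a const_pcarrier])
        moreover have "\<ominus>\<^bsub>polynomial_ring n\<^esub> a = - a"
          using R.r_neg[OF ac] by (simp add: eq_neg_iff_add_eq_0 add.commute)
        ultimately show ?thesis by (simp add: single_uminus)
      qed
      show "a \<oplus>\<^bsub>polynomial_ring n\<^esub> b \<in> J" if "a \<in> J" "b \<in> J" for a b
        using that by (simp add: J_def hcomp_add Iadd pcarrier_closed)
    qed
    show "x \<otimes>\<^bsub>polynomial_ring n\<^esub> a \<in> J" "a \<otimes>\<^bsub>polynomial_ring n\<^esub> x \<in> J"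
      if "a \<in> J" "x \<in> pcarrier n" for a x
      using mult[OF that] by (simp_all add: mult.commute)
  qed
  moreover have "H \<subseteq> J"
  proof
    fix f assume f: "f \<in> H"
    then obtain e where e: "f \<in> forms n e" using H by blast
    have "f \<in> I" unfolding I using R.genideal_self[OF Hc] f by blast
    then show "f \<in> J" using hcomp_of_form[OF e] I0 forms_pcarrier[OF e] by (simp add: J_def)
  qed
  ultimately have "I \<subseteq> J" unfolding I by (rule R.genideal_minimal)
  then show ?thesis using ideal by unfold_locales (auto simp: J_def)
qed

text \<open>The homogeneous elements of \<open>I\<close> generate it, because each element is the
  sum of its components.\<close>

lemma (in graded_quotient) homogeneous_ideal: "homogeneous_ideal n I"
proof -
  define H where "H = I \<inter> (\<Union>d. forms n d)"
  have Hc: "H \<subseteq> pcarrier n" using forms_pcarrier by (auto simp: H_def)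
  interpret J: ideal "Idl\<^bsub>polynomial_ring n\<^esub> H" "polynomial_ring n" by (rule R.genideal_ideal[OF Hc])
  have "Idl\<^bsub>polynomial_ring n\<^esub> H \<subseteq> I" by (rule R.genideal_minimal[OF ideal]) (simp add: H_def)
  moreover have "I \<subseteq> Idl\<^bsub>polynomial_ring n\<^esub> H"
  proof
    fix f assume f: "f \<in> I"
    obtain N where N: "f = (\<Sum>e\<le>N. hcomp e f)" by (rule sum_hcomp)
    have "hcomp d f \<in> H" for d
      using homogeneous[OF f] hcomp_forms[OF ideal_pcarrier[OF f]] by (auto simp: H_def)
    then have mem: "hcomp d f \<in> Idl\<^bsub>polynomial_ring n\<^esub> H" for d using R.genideal_self[OF Hc] by blast
    have "(\<Sum>e\<in>B. hcomp e f) \<in> Idl\<^bsub>polynomial_ring n\<^esub> H" if "finite B" for B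
      using that J.zero_closed J.a_closed mem by (induction B rule: finite_induct) auto
    then show "f \<in> Idl\<^bsub>polynomial_ring n\<^esub> H" using N by (metis finite_atMost)
  qed
  ultimately show ?thesis unfolding homogeneous_ideal_def by (intro exI[of _ H]) (auto simp: H_def)
qed

section \<open>Level algebras in coordinates\<close>

text \<open>The vector components 1, 2, 3 belong to the indices 0, 1, 2 of \<open>e\<close>.\<close>

definition linear_form :: "(nat \<Rightarrow> 'k::field mpoly) \<Rightarrow> 'k^3 \<Rightarrow> 'k mpoly" where
  "linear_form e l = const (l$1) * e 0 + const (l$2) * e 1 + const (l$3) * e 2"

lemma linear_form_add: "linear_form e (l + m) = linear_form e l + linear_form e m"
  by (simp add: linear_form_def single_add algebra_simps)

lemma linear_form_scale: "linear_form e (c *s l) = const c * linear_form e l"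
  by (simp add: linear_form_def const_mult algebra_simps)

lemma linear_form_0 [simp]: "linear_form e 0 = 0"
  by (simp add: linear_form_def)

lemma linear_form_forms:
  assumes "\<And>i. i < 3 \<Longrightarrow> e i \<in> forms n d"
  shows "linear_form e l \<in> forms n d"
  unfolding linear_form_def by (intro forms_add forms_const_mult assms) simp_all

context graded_quotient
begin

lemma lin_eq_linear_form: "lin e 3 c = linear_form e (vector [c 0, c 1, c 2])"
  by (simp add: lin_def linear_form_def numeral_3_eq_3 numeral_2_eq_2 vector_3)

lemma lin_forms:
  assumes "\<And>i. i < r \<Longrightarrow> v i \<in> forms n d"
  shows "lin v r c \<in> forms n d"
  using assms unfolding lin_def by (induction r) (auto intro!: forms_add forms_const_mult)

lemma lin_unit:
  assumes "i < r"
  shows "lin v r (\<lambda>j. if j = i then 1 else 0) = v i"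
proof -
  have "lin v r (\<lambda>j. if j = i then 1 else 0) = (\<Sum>j<r. if j = i then v j else 0)"
    unfolding lin_def by (rule sum.cong) auto
  then show ?thesis using assms by simp
qed

text \<open>Representatives can be taken homogeneous: each basis class lies in the component of
  degree \<open>d\<close>, so it is also the class of a form of that degree.\<close>

lemma dimension_forms:
  assumes "A.dimension r (gr 0) (gr d)"
  obtains v where "\<And>i. i < r \<Longrightarrow> v i \<in> forms n d"
    and "\<And>f. f \<in> forms n d \<Longrightarrow> \<exists>c. f - lin v r c \<in> I"
    and "\<And>c i. lin v r c \<in> I \<Longrightarrow> i < r \<Longrightarrow> c i = 0"
proof -
  from dimension_obtain[OF assms] obtain w where w': "(\<forall>i<r. w i \<in> pcarrier n) \<and>
    gr d = range (\<lambda>c. cls (lin w r c)) \<and> (\<forall>c. lin w r c \<in> I \<longrightarrow> (\<forall>i<r. c i = 0))" ..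
  then have w: "\<And>i. i < r \<Longrightarrow> w i \<in> pcarrier n" "gr d = range (\<lambda>c. cls (lin w r c))"
    "\<And>c i. lin w r c \<in> I \<Longrightarrow> i < r \<Longrightarrow> c i = 0"
    by auto
  have "\<exists>v. v \<in> forms n d \<and> w i - v \<in> I" if i: "i < r" for i
  proof -
    have "cls (lin w r (\<lambda>j. if j = i then 1 else 0)) \<in> gr d" unfolding w(2) by blast
    then have "cls (w i) \<in> cls ` forms n d" by (simp only: lin_unit[OF i] gr_def)
    then obtain v where "v \<in> forms n d" "cls (w i) = cls v" by blast
    then show ?thesis using cls_eq_iff[OF w(1)[OF i] forms_pcarrier] by blast
  qed
  then obtain v where v: "\<And>i. i < r \<Longrightarrow> v i \<in> forms n d" "\<And>i. i < r \<Longrightarrow> w i - v i \<in> I" by metis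
  have diff: "lin w r c - lin v r c \<in> I" for c
  proof -
    have "lin w r c - lin v r c = (\<Sum>i<r. const (c i) * (w i - v i))"
      by (simp add: lin_def right_diff_distrib sum_subtractf)
    also have "\<dots> \<in> I" using v(2) by (intro ideal_sum ideal_const_mult) simp
    finally show ?thesis .
  qed
  show ?thesis
  proof
    show "\<exists>c. f - lin v r c \<in> I" if f: "f \<in> forms n d" for f
    proof -
      have "cls f \<in> gr d" using f by (simp add: gr_def)
      then obtain c where "cls f = cls (lin w r c)" unfolding w(2) by blast
      then have "f - lin w r c \<in> I" using cls_eq_iff[OF forms_pcarrier[OF f] lin_closed] w(1) by blast
      then have "(f - lin w r c) + (lin w r c - lin v r c) \<in> I" using diff by (rule ideal_add)
      then show ?thesis by auto
    qed
    show "c i = 0" if "lin v r c \<in> I" "i < r" for c i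
      using w(3) ideal_cong[OF diff] that by blast
  qed (rule v(1))
qed

lemma coordinates:
  assumes "A.dimension r (gr 0) (gr d)"
  obtains v X where "\<And>i. i < r \<Longrightarrow> v i \<in> forms n d"
    and "\<And>f. f \<in> forms n d \<Longrightarrow> f - lin v r (X f) \<in> I"
    and "\<And>f c i. f - lin v r c \<in> I \<Longrightarrow> i < r \<Longrightarrow> X f i = c i"
proof (rule dimension_forms[OF assms])
  fix v assume v: "\<And>i. i < r \<Longrightarrow> v i \<in> forms n d" "\<And>f. f \<in> forms n d \<Longrightarrow> \<exists>c. f - lin v r c \<in> I"
    "\<And>c i. lin v r c \<in> I \<Longrightarrow> i < r \<Longrightarrow> c i = 0"
  define X where "X f = (SOME c. f - lin v r c \<in> I)" for f
  have X: "f - lin v r (X f) \<in> I" if "\<exists>c. f - lin v r c \<in> I" for f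
    unfolding X_def using that by (rule someI_ex)
  show ?thesis
  proof
    show "X f i = c i" if "f - lin v r c \<in> I" "i < r" for f c i
    proof -
      have "(f - lin v r c) - (f - lin v r (X f)) \<in> I" using that(1) X by (blast intro: ideal_diff)
      then have "lin v r (\<lambda>i. X f i - c i) \<in> I" by (simp flip: lin_diff)
      from v(3)[OF this that(2)] show ?thesis by simp
    qed
    show "f - lin v r (X f) \<in> I" if "f \<in> forms n d" for f
      by (rule X[OF v(2)[OF that]])
  qed (rule v(1))
qed

end

text \<open>A level algebra of codimension three and type two in coordinates: \<open>e\<close>
  represents a basis of degree one, and \<open>F\<close> gives two coordinates on degree
  \<open>s\<close>, which is the whole socle. \<open>no_socle\<close> expresses that nothing of
  lower degree lies in the socle.\<close>

locale level_coordinates = graded_quotient n I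
  for n and I :: "'k::field_char_0 mpoly set" +
  fixes s :: nat and e :: "nat \<Rightarrow> 'k mpoly" and F :: "bool \<Rightarrow> 'k mpoly \<Rightarrow> 'k"
  assumes e_form: "i < 3 \<Longrightarrow> e i \<in> forms n 1"
    and e_span: "f \<in> forms n 1 \<Longrightarrow> \<exists>l. f - linear_form e l \<in> I"
    and e_indep: "linear_form e l \<in> I \<Longrightarrow> l = 0"
    and F_add: "f \<in> forms n s \<Longrightarrow> g \<in> forms n s \<Longrightarrow> F b (f + g) = F b f + F b g"
    and F_scale: "f \<in> forms n s \<Longrightarrow> F b (const c * f) = c * F b f"
    and F_ideal: "f \<in> forms n s \<Longrightarrow> f \<in> I \<longleftrightarrow> (\<forall>b. F b f = 0)"
    and F_indep: "(\<And>f. f \<in> forms n s \<Longrightarrow> \<alpha> * F True f + \<gamma> * F False f = 0) \<Longrightarrow> \<alpha> = 0 \<and> \<gamma> = 0"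
    and top: "d > s \<Longrightarrow> forms n d \<subseteq> I"
    and no_socle: "f \<in> forms n d \<Longrightarrow> d < s \<Longrightarrow> (\<And>g. g \<in> forms n 1 \<Longrightarrow> g * f \<in> I) \<Longrightarrow> f \<in> I"

text \<open>The component of degree \<open>s\<close> lies in the socle because degree
  \<open>s + 1\<close> vanishes, and levelness gives the converse. So \<open>F\<close> can be read
  off from a basis of the two-dimensional socle.\<close>

lemma level_coordinates_if_level:
  fixes I :: "'k::field_char_0 mpoly set"
  assumes gq: "graded_quotient n I"
    and codim: "codimension (polynomial_ring n Quot I) (quotient_grading n I) 3"
    and level: "level (polynomial_ring n Quot I) (quotient_grading n I) 2 s"
  obtains e F where "level_coordinates n I s e F"
proof -
  interpret graded_quotient n I by (rule gq)
  have dim1: "A.dimension 3 (gr 0) (gr 1)" using codim by (simp add: codimension_def)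
  have dims: "A.dimension 2 (gr 0) (socle A gr)" and soc: "socle A gr \<subseteq> gr s"
    and top: "\<And>d. d > s \<Longrightarrow> forms n d \<subseteq> I"
    using level by (auto simp: level_def socle_degree_def gr_eq_zero_iff)
  \<comment> \<open>Annihilation by linear forms is enough, since \<open>forms_Suc_induct\<close>
    builds all forms of positive degree from multiples of linear ones.\<close>
  have socle_eq: "cls f \<in> socle A gr" if f: "f \<in> pcarrier n" and ann: "\<And>g. g \<in> forms n 1 \<Longrightarrow> g * f \<in> I" for f
  proof -
    have "g * f \<in> I" if "g \<in> forms n (Suc i)" for g i
      using that
    proof (induction g rule: forms_Suc_induct)
      case (mult a b)
      have "b * (a * f) \<in> I" using ann[OF mult(1)] forms_pcarrier[OF mult(2)] by (rule ideal_mult(1))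
      then show ?case by (simp add: mult_ac)
    qed (auto simp: distrib_right ideal_add)
    then have "cls g \<otimes>\<^bsub>A\<^esub> cls f = \<zero>\<^bsub>A\<^esub>" if "g \<in> forms n i" "i \<ge> 1" for g i
      using that f by (cases i) (simp_all add: cls_eq_zero_iff pcarrier_closed(3) forms_pcarrier)
    then show ?thesis using f by (auto simp: socle_def gr_def cls_closed)
  qed
  have "gr s \<subseteq> socle A gr"
  proof
    fix x assume "x \<in> gr s"
    then obtain f where f: "f \<in> forms n s" "x = cls f" by (auto simp: gr_def)
    then have "g * f \<in> I" if "g \<in> forms n 1" for g
      using top[of "1 + s"] forms_mult[OF that f(1)] by auto
    then show "x \<in> socle A gr" using socle_eq f forms_pcarrier by blast
  qed
  then have dims: "A.dimension 2 (gr 0) (gr s)" using dims soc by simp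
  show ?thesis
  proof (rule coordinates[OF dim1], rule coordinates[OF dims])
    fix e X w Y
    assume e: "\<And>i. i < 3 \<Longrightarrow> e i \<in> forms n 1"
      and X: "\<And>f. f \<in> forms n 1 \<Longrightarrow> f - lin e 3 (X f) \<in> I"
      and X_unique: "\<And>f c i. f - lin e 3 c \<in> I \<Longrightarrow> i < 3 \<Longrightarrow> X f i = c i"
      and w: "\<And>i. i < 2 \<Longrightarrow> w i \<in> forms n s"
      and Y: "\<And>f. f \<in> forms n s \<Longrightarrow> f - lin w 2 (Y f) \<in> I"
      and Y_unique: "\<And>f c i. f - lin w 2 c \<in> I \<Longrightarrow> i < 2 \<Longrightarrow> Y f i = c i"
    define idx :: "bool \<Rightarrow> nat" where "idx b = (if b then 0 else 1)" for b
    have idx: "idx b < 2" for b by (simp add: idx_def)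
    define F where "F b f = Y f (idx b)" for b f
    have lin_0: "lin v r (\<lambda>_. 0) = 0" for v r by (simp add: lin_def)
    have lin_add: "lin v r (\<lambda>i. c i + d i) = lin v r c + lin v r d" for v r c d
      by (simp add: lin_def single_add distrib_right sum.distrib)
    have lin_scale: "lin v r (\<lambda>i. a * c i) = const a * lin v r c" for v r a c
      by (simp add: lin_def const_mult sum_distrib_left mult.assoc)
    have "level_coordinates n I s e F"
    proof unfold_locales
      show "\<exists>l. f - linear_form e l \<in> I" if "f \<in> forms n 1" for f
        using X[OF that] unfolding lin_eq_linear_form by blast
      show "l = 0" if "linear_form e l \<in> I" for l
      proof -
        define c where "c i = (if i = 0 then l$1 else if i = 1 then l$2 else l$3)" for i :: nat
        have "linear_form e l = lin e 3 c" by (simp add: lin_eq_linear_form c_def linear_form_def vector_3)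
        then have "0 - lin e 3 c \<in> I" using that ideal_uminus by simp
        then have "X 0 i = c i" if "i < 3" for i using X_unique that by blast
        moreover have "X 0 i = 0" if "i < 3" for i using X_unique[of 0 "\<lambda>_. 0"] that by (simp add: lin_0)
        ultimately have "c 0 = 0" "c 1 = 0" "c 2 = 0" by (metis numeral_less_iff one_less_numeral_iff semiring_norm zero_less_numeral)+
        then show ?thesis by (simp add: c_def vec_eq_iff forall_3)
      qed
      show "F b (f + g) = F b f + F b g" if "f \<in> forms n s" "g \<in> forms n s" for b f g
      proof -
        have "f + g - lin w 2 (\<lambda>i. Y f i + Y g i) \<in> I"
          using ideal_add[OF Y[OF that(1)] Y[OF that(2)]] by (simp add: lin_add algebra_simps)
        then show ?thesis unfolding F_def using Y_unique idx by blast
      qed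
      show "F b (const c * f) = c * F b f" if "f \<in> forms n s" for b c f
      proof -
        have "const c * f - lin w 2 (\<lambda>i. c * Y f i) \<in> I"
          using ideal_const_mult[OF Y[OF that], of c] by (simp add: lin_scale right_diff_distrib)
        then show ?thesis unfolding F_def using Y_unique idx by blast
      qed
      show "f \<in> I \<longleftrightarrow> (\<forall>b. F b f = 0)" if f: "f \<in> forms n s" for f
      proof
        assume "f \<in> I"
        then have "f - lin w 2 (\<lambda>_. 0) \<in> I" by (simp add: lin_0)
        then show "\<forall>b. F b f = 0" unfolding F_def using Y_unique idx by blast
      next
        assume "\<forall>b. F b f = 0"
        then have "Y f 0 = 0" "Y f 1 = 0" by (auto simp: F_def idx_def all_bool_eq)
        then have "lin w 2 (Y f) = lin w 2 (\<lambda>_. 0)" by (intro lin_cong) (auto simp: less_2_cases_iff)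
        then show "f \<in> I" using Y[OF f] by (simp add: lin_0)
      qed
      show "\<alpha> = 0 \<and> \<gamma> = 0" if *: "\<And>f. f \<in> forms n s \<Longrightarrow> \<alpha> * F True f + \<gamma> * F False f = 0" for \<alpha> \<gamma>
      proof -
        have "F b (w i) = (if idx b = i then 1 else 0)" if "i < 2" for b i
          unfolding F_def using Y_unique[of "w i" "\<lambda>j. if j = i then 1 else 0" "idx b"] idx[of b]
          by (simp add: lin_unit[OF that])
        then show ?thesis using *[OF w[of 0]] *[OF w[of 1]] by (simp add: idx_def)
      qed
      show "f \<in> I" if f: "f \<in> forms n d" "d < s" and ann: "\<And>g. g \<in> forms n 1 \<Longrightarrow> g * f \<in> I" for f d
      proof -
        have "cls f \<in> gr s" using socle_eq[OF forms_pcarrier[OF f(1)] ann] soc by blast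
        then obtain h where h: "h \<in> forms n s" "cls f = cls h" unfolding gr_def by blast
        then have "f - h \<in> I" using cls_eq_iff[OF forms_pcarrier[OF f(1)] forms_pcarrier[OF h(1)]] by blast
        note h = h(1) this
        \<comment> \<open>\<open>f\<close> and \<open>h\<close> have different degrees, so this
          component is \<open>f\<close> itself.\<close>
        have "hcomp d (f - h) \<in> I" using h(2) by (rule homogeneous)
        then show ?thesis using hcomp_of_form[OF f(1)] hcomp_of_form[OF h(1)] f(2) by (simp add: hcomp_diff)
      qed
    qed (use e top in auto)
    then show ?thesis using that by blast
  qed
qed

section \<open>Pairing with the socle\<close>

context level_coordinates
begin

abbreviation lf where "lf \<equiv> linear_form e"

lemma lf_form [simp]: "lf l \<in> forms n 1"
  using e_form by (rule linear_form_forms)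

lemma lf_form_Suc_0 [simp]: "lf l \<in> forms n (Suc 0)"
  using lf_form[of l] by simp

lemma F_diff:
  assumes "f \<in> forms n s" "g \<in> forms n s"
  shows "F b (f - g) = F b f - F b g"
  using F_add[OF forms_diff[OF assms] assms(2), of b] by (simp add: eq_diff_eq)

lemma F_0 [simp]: "F b 0 = 0"
  using F_ideal[of 0] by simp

lemma lf_mult_forms:
  assumes "s = Suc d" "h \<in> forms n d"
  shows "lf l * h \<in> forms n s"
  using forms_mult[OF lf_form assms(2)] assms(1) by simp

text \<open>The coefficient vector of the functional sending \<open>l\<close> to
  \<open>F b (lf l * h)\<close>. The default 0 lets \<open>h\<close> range over all polynomials in
  \<open>pencil_rank_two\<close>.\<close>

definition a :: "bool \<Rightarrow> 'k mpoly \<Rightarrow> 'k^3" where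
  "a b h = (if h \<in> forms n (s - 1) then vector [F b (e 0 * h), F b (e 1 * h), F b (e 2 * h)] else 0)"

lemma dot_a:
  assumes s: "s = Suc d" and h: "h \<in> forms n d"
  shows "dot (a b h) l = F b (lf l * h)"
proof -
  have "e i * h \<in> forms n s" if "i < 3" for i
    using forms_mult[OF e_form[OF that] h] by (simp add: s)
  then have forms: "e 0 * h \<in> forms n s" "e 1 * h \<in> forms n s" "e 2 * h \<in> forms n s" by simp_all
  have "lf l * h = const (l$1) * (e 0 * h) + const (l$2) * (e 1 * h) + const (l$3) * (e 2 * h)"
    by (simp add: linear_form_def algebra_simps)
  then have "F b (lf l * h) = l$1 * F b (e 0 * h) + l$2 * F b (e 1 * h) + l$3 * F b (e 2 * h)"
    using forms by (simp add: F_add F_scale forms_add forms_const_mult)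
  moreover have "h \<in> forms n (s - 1)" using h by (simp add: s)
  ultimately show ?thesis by (simp add: a_def dot_def vector_3 mult.commute)
qed

text \<open>In socle degree 0 the component of degree one vanishes; in socle degree 1 the two
  functionals \<open>F\<close> embed it in a plane. Neither is possible in codimension
  three.\<close>

lemma socle_degree_ge_2: "s \<ge> 2"
proof (rule ccontr)
  assume "\<not> 2 \<le> s"
  then consider "s = 0" | "s = 1" by linarith
  then have "\<exists>l. l \<noteq> 0 \<and> lf l \<in> I"
  proof cases
    case 1
    then have "lf 1 \<in> I" using top[of 1] lf_form by auto
    then show ?thesis by (metis one_index zero_index zero_neq_one)
  next
    case 2
    have one: "1 \<in> (forms n 0 :: 'k mpoly set)" using forms_const[of 1 n] by simp
    obtain l where l: "l \<noteq> 0" "dot (a True 1) l = 0" "dot (a False 1) l = 0"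
      using two_functionals_common_zero by blast
    then have "\<forall>b. F b (lf l) = 0"
      using dot_a[of 0 1 _ l] one 2 by (simp add: all_bool_eq)
    then have "lf l \<in> I" using F_ideal[of "lf l"] 2 by simp
    then show ?thesis using l(1) by blast
  qed
  then show False using e_indep by blast
qed

text \<open>Non-degeneracy of multiplication up to the socle degree: one linear factor of
  \<open>h\<close> at a time is moved over to \<open>f\<close>, and \<open>no_socle\<close> is
  applied each time.\<close>

lemma eq_0_if_annihilates:
  assumes "f \<in> forms n i" "i + j \<le> s" "\<And>h. h \<in> forms n j \<Longrightarrow> f * h \<in> I"
  shows "f \<in> I"
  using assms
proof (induction j arbitrary: f i)
  case 0
  have "f * 1 \<in> I" using 0(3) forms_const[of 1 n] by fastforce
  then show ?case by simp
next
  case (Suc j)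
  show ?case
  proof (rule no_socle[OF Suc.prems(1)])
    show "i < s" using Suc.prems(2) by simp
    fix g assume g: "g \<in> (forms n 1 :: 'k mpoly set)"
    show "g * f \<in> I"
    proof (rule Suc.IH[of _ "1 + i"])
      show "g * f \<in> forms n (1 + i)" using g Suc.prems(1) by (rule forms_mult)
      show "1 + i + j \<le> s" using Suc.prems(2) by simp
      fix h assume "h \<in> (forms n j :: 'k mpoly set)"
      then have "g * h \<in> forms n (Suc j)" using forms_mult[OF g] by fastforce
      then have "f * (g * h) \<in> I" by (rule Suc.prems(3))
      then show "g * f * h \<in> I" by (simp add: mult_ac)
    qed
  qed
qed

text \<open>The hypotheses of \<open>pencil_rank_two\<close> hold: a linear form killing degree
  \<open>s - 1\<close> is zero by \<open>eq_0_if_annihilates\<close>, and a relation between the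
  functionals on products \<open>lf l * h\<close> holds on all of degree \<open>s\<close>, which
  these products span modulo \<open>I\<close>.\<close>

lemma exists_rank_two: "\<exists>l h h'. dot (a True h) l * dot (a False h') l - dot (a True h') l * dot (a False h) l \<noteq> 0"
proof (rule pencil_rank_two)
  obtain d where s: "s = Suc d" using socle_degree_ge_2 by (cases s) auto
  show "l = 0" if "\<And>h. dot (a True h) l = 0" "\<And>h. dot (a False h) l = 0" for l
  proof -
    have "lf l * h \<in> I" if h: "h \<in> forms n d" for h
    proof -
      have "F b (lf l * h) = 0" for b
        using \<open>dot (a True h) l = 0\<close> \<open>dot (a False h) l = 0\<close> dot_a[OF s h, of b l] by (cases b) simp_all
      then show ?thesis using F_ideal[OF lf_mult_forms[OF s h]] by simp
    qed
    then have "lf l \<in> I" using eq_0_if_annihilates[OF lf_form, of d] by (simp add: s)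
    then show ?thesis by (rule e_indep)
  qed
  show "\<alpha> = 0 \<and> \<gamma> = 0" if *: "\<And>l h. \<alpha> * dot (a True h) l + \<gamma> * dot (a False h) l = 0" for \<alpha> \<gamma>
  proof (rule F_indep)
    fix f assume f: "f \<in> (forms n s :: 'k mpoly set)"
    then have "f \<in> forms n (Suc d)" by (simp add: s)
    \<comment> \<open>Membership in \<open>forms n s\<close> is carried through the induction
      because \<open>F\<close> is known to be additive only there.\<close>
    then have "f \<in> forms n s \<and> \<alpha> * F True f + \<gamma> * F False f = 0"
    proof (induction f rule: forms_Suc_induct)
      case (add f g)
      then have "\<alpha> * F True (f + g) + \<gamma> * F False (f + g)
        = (\<alpha> * F True f + \<gamma> * F False f) + (\<alpha> * F True g + \<gamma> * F False g)"
        by (simp add: F_add algebra_simps del: add_eq_0_iff)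
      with add show ?case by (simp add: forms_add)
    next
      case (mult f h)
      obtain l where l: "f - lf l \<in> I" using e_span mult(1) by blast
      have fh: "f * h \<in> forms n s" using forms_mult[OF mult] by (simp add: s)
      have "(f - lf l) * h \<in> I" using l forms_pcarrier[OF mult(2)] by (rule ideal_mult(2))
      then have "f * h - lf l * h \<in> I" by (simp add: left_diff_distrib)
      then have "F b (f * h) = F b (lf l * h)" for b
        using F_ideal[OF forms_diff[OF fh lf_mult_forms[OF s mult(2)]]] F_diff[OF fh lf_mult_forms[OF s mult(2)]]
        by simp
      then show ?case using *[of h l] fh dot_a[OF s mult(2)] by simp
    qed simp
    then show "\<alpha> * F True f + \<gamma> * F False f = 0" by blast
  qed
qed

definition pencil_minor :: "'k mpoly \<Rightarrow> 'k mpoly \<Rightarrow> 'k^3 \<Rightarrow> 'k" where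
  "pencil_minor h h' l = dot (a True h) l * dot (a False h') l - dot (a True h') l * dot (a False h) l"

lemma pencil_minor_coord_polys: "pencil_minor h h' \<in> coord_polys"
  unfolding pencil_minor_def by (intro coord_polys_intros coord_polys_dot)

section \<open>From non-vanishing minors to maximal rank\<close>

lemma maximal_rank_if_injective:
  assumes "\<And>f. f \<in> forms n i \<Longrightarrow> lf l * f \<in> I \<Longrightarrow> f \<in> I"
  shows "maximal_rank A gr (cls (lf l)) i"
proof -
  have "inj_on (\<lambda>x. cls (lf l) \<otimes>\<^bsub>A\<^esub> x) (gr i)"
  proof (rule inj_onI)
    fix x y assume "x \<in> gr i" "y \<in> gr i" and eq: "cls (lf l) \<otimes>\<^bsub>A\<^esub> x = cls (lf l) \<otimes>\<^bsub>A\<^esub> y"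
    then obtain f g where fg: "f \<in> forms n i" "x = cls f" "g \<in> forms n i" "y = cls g" by (auto simp: gr_def)
    note closed = fg(1,3)[THEN forms_pcarrier] forms_pcarrier[OF lf_form[of l]]
    have "lf l * f - lf l * g \<in> I" using eq closed by (simp add: fg cls_eq_iff pcarrier_closed(3))
    then have "f - g \<in> I" using assms[OF forms_diff[OF fg(1,3)]] by (simp add: right_diff_distrib)
    then show "x = y" using closed by (simp add: fg cls_eq_iff)
  qed
  then show ?thesis by (simp add: maximal_rank_def)
qed

lemma maximal_rank_if_surjective:
  assumes "\<And>f. f \<in> forms n (Suc i) \<Longrightarrow> \<exists>g\<in>forms n i. f - lf l * g \<in> I"
  shows "maximal_rank A gr (cls (lf l)) i"
proof -
  have "(\<lambda>x. cls (lf l) \<otimes>\<^bsub>A\<^esub> x) ` gr i = gr (Suc i)"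
  proof (intro equalityI subsetI)
    fix x assume "x \<in> (\<lambda>x. cls (lf l) \<otimes>\<^bsub>A\<^esub> x) ` gr i"
    then obtain g where g: "g \<in> forms n i" "x = cls (lf l) \<otimes>\<^bsub>A\<^esub> cls g" by (auto simp: gr_def)
    then have "x = cls (lf l * g)" using forms_pcarrier[OF g(1)] forms_pcarrier[OF lf_form] by simp
    moreover have "lf l * g \<in> forms n (Suc i)" using forms_mult[OF lf_form g(1)] by simp
    ultimately show "x \<in> gr (Suc i)" by (simp add: gr_def)
  next
    fix x assume "x \<in> gr (Suc i)"
    then obtain f where f: "f \<in> forms n (Suc i)" "x = cls f" by (auto simp: gr_def)
    then obtain g where g: "g \<in> forms n i" "f - lf l * g \<in> I" using assms by blast
    then have "x = cls (lf l) \<otimes>\<^bsub>A\<^esub> cls g"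
      using f(2) forms_pcarrier[OF f(1)] forms_pcarrier[OF g(1)] forms_pcarrier[OF lf_form[of l]]
      by (simp add: cls_eq_iff pcarrier_closed(3))
    then show "x \<in> (\<lambda>x. cls (lf l) \<otimes>\<^bsub>A\<^esub> x) ` gr i" using g(1) by (auto simp: gr_def)
  qed
  then show ?thesis by (simp add: maximal_rank_def)
qed

text \<open>The images of \<open>h\<close> and \<open>h'\<close> are independent in the
  two-dimensional top component, so Cramer's rule gives a combination of \<open>h\<close> and
  \<open>h'\<close> that maps to any prescribed class.\<close>

lemma surjective_if_pencil_minor:
  assumes D: "pencil_minor h h' l \<noteq> 0" and s: "s = Suc d"
  shows "maximal_rank A gr (cls (lf l)) d"
proof (rule maximal_rank_if_surjective)
  \<comment> \<open>By the default value of \<open>a\<close>, a non-zero minor forces both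
    polynomials to be forms of degree \<open>d\<close>.\<close>
  have h: "h \<in> forms n d" "h' \<in> forms n d" using D unfolding pencil_minor_def a_def by (auto simp: s split: if_splits)
  note lh = lf_mult_forms[OF s h(1), of l] lf_mult_forms[OF s h(2), of l]
  define D where "D = pencil_minor h h' l"
  have D_eq: "D = F True (lf l * h) * F False (lf l * h') - F True (lf l * h') * F False (lf l * h)"
    by (simp add: D_def pencil_minor_def dot_a[OF s h(1)] dot_a[OF s h(2)])
  have D0: "D \<noteq> 0" using D by (simp add: D_def)
  fix f assume "f \<in> (forms n (Suc d) :: 'k mpoly set)"
  then have f: "f \<in> forms n s" by (simp add: s)
  define \<alpha> where "\<alpha> = (F True f * F False (lf l * h') - F False f * F True (lf l * h')) / D"
  define \<gamma> where "\<gamma> = (F False f * F True (lf l * h) - F True f * F False (lf l * h)) / D"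
  define g where "g = const \<alpha> * h + const \<gamma> * h'"
  have g: "g \<in> forms n d" unfolding g_def using h by (intro forms_add forms_const_mult)
  have "lf l * g = const \<alpha> * (lf l * h) + const \<gamma> * (lf l * h')"
    by (simp add: g_def algebra_simps)
  then have "F b (lf l * g) = \<alpha> * F b (lf l * h) + \<gamma> * F b (lf l * h')" for b
    using lh by (simp add: F_add F_scale forms_const_mult)
  moreover have "D * (\<alpha> * F b (lf l * h) + \<gamma> * F b (lf l * h')) = D * F b f" for b
  proof -
    have num: "D * \<alpha> = F True f * F False (lf l * h') - F False f * F True (lf l * h')"
      "D * \<gamma> = F False f * F True (lf l * h) - F True f * F False (lf l * h)"
      using D0 by (simp_all add: \<alpha>_def \<gamma>_def)
    have "D * (\<alpha> * F b (lf l * h) + \<gamma> * F b (lf l * h'))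
      = (D * \<alpha>) * F b (lf l * h) + (D * \<gamma>) * F b (lf l * h')"
      by (simp only: distrib_left mult.assoc)
    also have "\<dots> = D * F b f"
      unfolding num unfolding D_eq by (cases b) (simp_all add: algebra_simps)
    finally show ?thesis .
  qed
  ultimately have "F b (lf l * g) = F b f" for b using D0 by simp
  then have "f - lf l * g \<in> I"
    using F_ideal[OF forms_diff[OF f lf_mult_forms[OF s g]]] F_diff[OF f lf_mult_forms[OF s g]] by simp
  then show "\<exists>g\<in>forms n d. f - lf l * g \<in> I" using g by blast
qed

lemma maximal_rank_trivial: "i \<ge> s \<Longrightarrow> maximal_rank A gr (cls (lf l)) i"
proof (rule maximal_rank_if_surjective)
  fix f assume i: "i \<ge> s" and f: "f \<in> (forms n (Suc i) :: 'k mpoly set)"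
  have "f - lf l * 0 \<in> I" using top[of "Suc i"] i f by auto
  then show "\<exists>g\<in>forms n i. f - lf l * g \<in> I" using forms_0 by blast
qed

lemma maximal_rank_0: "l \<noteq> 0 \<Longrightarrow> maximal_rank A gr (cls (lf l)) 0"
proof (rule maximal_rank_if_injective)
  fix f assume l: "l \<noteq> 0" and f: "f \<in> (forms n 0 :: 'k mpoly set)" and I: "lf l * f \<in> I"
  obtain c where c: "f = const c" using forms_degree_0[OF f] by blast
  have "lf (c *s l) \<in> I" using I by (simp add: c linear_form_scale mult.commute)
  then have "c *s l = 0" by (rule e_indep)
  then have "c = 0" using l by (simp add: vec_eq_iff) blast
  then show "f \<in> I" by (simp add: c)
qed

section \<open>Coordinates on degree one and Zariski-open sets\<close>

lemma linear_form_unique: "lf l - lf m \<in> I \<Longrightarrow> l = m"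
proof -
  assume "lf l - lf m \<in> I"
  moreover have "lf l - lf m = lf (l + (-1) *s m)"
    by (simp add: linear_form_def single_add single_diff single_uminus algebra_simps)
  ultimately have "lf (l + (-1) *s m) \<in> I" by (simp only:)
  then have "l + (-1) *s m = 0" by (rule e_indep)
  then show "l = m" by simp
qed

lemma cls_lf_eq_iff: "cls (lf l) = cls (lf m) \<longleftrightarrow> l = m"
  using linear_form_unique cls_eq_iff[OF forms_pcarrier[OF lf_form] forms_pcarrier[OF lf_form]] by blast

definition coords :: "'k mpoly set \<Rightarrow> 'k^3" where
  "coords x = (THE l. x = cls (lf l))"

lemma coords_cls [simp]: "coords (cls (lf l)) = l"
  unfolding coords_def by (rule the_equality) (auto simp: cls_lf_eq_iff)

lemma gr_1_cases:
  assumes "x \<in> gr 1" obtains l where "x = cls (lf l)"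
proof -
  obtain f where f: "f \<in> forms n 1" "x = cls f" using assms by (auto simp: gr_def)
  then obtain l where "f - lf l \<in> I" using e_span by blast
  then have "x = cls (lf l)" using f cls_eq_iff[OF forms_pcarrier[OF f(1)] forms_pcarrier[OF lf_form]] by blast
  then show ?thesis using that by blast
qed

text \<open>Coordinates on degree one are linear functionals with values in the ground field
  \<open>gr 0\<close>, and both inductive sets are closed under the same operations.\<close>

lemma coord_polys_polynomial_functions:
  assumes "p \<in> coord_polys"
  shows "(\<lambda>x. cls (const (p (coords x)))) \<in> polynomial_functions A (gr 0) (gr 1)"
  using assms
proof induction
  case (const c)
  have "cls (const c) \<in> gr 0" by (simp add: gr_0)
  then show ?case by (rule polynomial_functions.const)
next
  case (coord i)
  have closed [simp]: "lf l \<in> pcarrier n" for l by (rule forms_pcarrier[OF lf_form])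
  have "linear_functional A (gr 0) (gr 1) (\<lambda>x. cls (const (coords x $ i)))"
    unfolding linear_functional_def
  proof (intro conjI ballI)
    show "cls (const (coords x $ i)) \<in> gr 0" for x by (simp add: gr_0)
    show "cls (const (coords (x \<oplus>\<^bsub>A\<^esub> y) $ i)) = cls (const (coords x $ i)) \<oplus>\<^bsub>A\<^esub> cls (const (coords y $ i))"
      if xy: "x \<in> gr 1" "y \<in> gr 1" for x y
    proof -
      obtain l m where "x = cls (lf l)" "y = cls (lf m)" using gr_1_cases xy by metis
      then show ?thesis by (simp add: single_add flip: linear_form_add)
    qed
    show "cls (const (coords (c \<otimes>\<^bsub>A\<^esub> x) $ i)) = c \<otimes>\<^bsub>A\<^esub> cls (const (coords x $ i))"
      if cx: "c \<in> gr 0" "x \<in> gr 1" for c x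
    proof -
      obtain k where k: "c = cls (const k)" using cx(1) unfolding gr_0 by blast
      obtain l where l: "x = cls (lf l)" by (rule gr_1_cases[OF cx(2)])
      from k l show ?thesis by (simp add: const_mult[symmetric] flip: linear_form_scale)
    qed
  qed
  then show ?case by (rule polynomial_functions.linear)
next
  case (add p q)
  then show ?case using polynomial_functions.add[OF add.IH] by (simp add: single_add)
next
  case (mult p q)
  then show ?case using polynomial_functions.mult[OF mult.IH] by (simp add: const_mult)
qed

lemma const_notin_ideal: "c \<noteq> 0 \<Longrightarrow> const c \<notin> I"
proof
  assume "c \<noteq> 0" "const c \<in> I"
  then have "const c * lf 1 \<in> I" using ideal_mult(2) forms_pcarrier[OF lf_form] by blast
  then have "lf 1 \<in> I" using ideal_const_mult_iff \<open>c \<noteq> 0\<close> by blast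
  then have "(1::'k^3) = 0" by (rule e_indep)
  then show False by (simp add: vec_eq_iff)
qed

text \<open>The open set is the non-vanishing locus of \<open>p\<close>;
  \<open>const_notin_ideal\<close> ensures that a non-zero value of \<open>p\<close> stays non-zero
  as a class in \<open>gr 0\<close>.\<close>

lemma weak_lefschetz_if_polynomial:
  assumes p: "p \<in> coord_polys" "p l0 \<noteq> 0"
    and rank: "\<And>l i. p l \<noteq> 0 \<Longrightarrow> maximal_rank A gr (cls (lf l)) i"
  shows "weak_lefschetz A gr"
proof -
  define \<phi> where "\<phi> x = cls (const (p (coords x)))" for x
  define U where "U = {x \<in> gr 1. \<exists>q\<in>{\<phi>}. q x \<noteq> \<zero>\<^bsub>A\<^esub>}"
  have "\<phi> \<in> polynomial_functions A (gr 0) (gr 1)"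
    unfolding \<phi>_def using p(1) by (rule coord_polys_polynomial_functions)
  then have "zariski_open A (gr 0) (gr 1) U" unfolding zariski_open_def U_def by blast
  moreover have mem: "cls (lf l) \<in> U \<longleftrightarrow> p l \<noteq> 0" for l
    using const_notin_ideal[of "p l"] by (auto simp: U_def \<phi>_def gr_def cls_eq_zero_iff)
  moreover have "maximal_rank A gr L i" if L: "L \<in> U" for L i
  proof -
    have "L \<in> gr 1" using L by (simp add: U_def)
    then obtain l where "L = cls (lf l)" by (rule gr_1_cases)
    then show ?thesis using L mem rank by blast
  qed
  ultimately show ?thesis unfolding weak_lefschetz_def using p(2) by blast
qed

section \<open>Socle degree at most three\<close>

definition T :: "'k^3 \<Rightarrow> 'k^3 \<Rightarrow> 'k^3 \<Rightarrow> bool \<Rightarrow> 'k" where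
  "T l m v b = F b (lf l * lf m * lf v)"

text \<open>Symmetry is commutativity of the product. For non-degeneracy,
  \<open>eq_0_if_annihilates\<close> is applied twice: first to drop the factor \<open>lf v\<close>,
  then the factor \<open>lf m\<close>.\<close>

lemma cubic_pair_T:
  assumes s: "s = 3"
  shows "cubic_pair T"
proof
  have forms: "lf l * lf m * lf v \<in> forms n s" for l m v
    using forms_mult[OF forms_mult[OF lf_form lf_form] lf_form, of l m v] by (simp add: s numeral_3_eq_3)
  show "T (l + l') m v b = T l m v b + T l' m v b" for l l' m v b
    using F_add[OF forms forms] by (simp add: T_def linear_form_add distrib_right)
  show "T (c *s l) m v b = c * T l m v b" for c l m v b
    using F_scale[OF forms] by (simp add: T_def linear_form_scale mult.assoc)
  show "T l m v b = T m l v b" "T l m v b = T l v m b" for l m v b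
    by (simp_all add: T_def mult_ac)
  show "l = 0" if zero: "\<And>m v b. T l m v b = 0" for l
  proof -
    have lmv: "lf l * lf m * lf v \<in> I" for m v
      using F_ideal[OF forms] zero by (simp add: T_def)
    have "lf l * lf m * g \<in> I" if g: "g \<in> forms n 1" for m g
    proof -
      obtain v where "g - lf v \<in> I" using e_span g by blast
      then have "lf l * lf m * (g - lf v) \<in> I"
        by (intro ideal_mult(1) forms_pcarrier[OF forms_mult[OF lf_form lf_form]])
      then show ?thesis using lmv ideal_cong by (simp add: right_diff_distrib)
    qed
    then have "lf l * lf m \<in> I" for m
      using eq_0_if_annihilates[OF forms_mult[OF lf_form lf_form], of 1 l m] by (simp add: s)
    then have "lf l * g \<in> I" if g: "g \<in> forms n 1" for g
    proof -
      obtain v where "g - lf v \<in> I" using e_span g by blast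
      then have "lf l * (g - lf v) \<in> I" by (intro ideal_mult(1) forms_pcarrier[OF lf_form])
      then show ?thesis using \<open>\<And>m. lf l * lf m \<in> I\<close> ideal_cong by (simp add: right_diff_distrib)
    qed
    then have "lf l \<in> I" using eq_0_if_annihilates[OF lf_form, of 1 l] by (simp add: s)
    then show ?thesis by (rule e_indep)
  qed
qed

lemma maximal_rank_1:
  assumes s: "s = 3" and D: "cubic_pair.minor T i j k l \<noteq> 0"
  shows "maximal_rank A gr (cls (lf l)) 1"
proof (rule maximal_rank_if_injective)
  interpret T: cubic_pair T using s by (rule cubic_pair_T)
  fix f assume f: "f \<in> (forms n 1 :: 'k mpoly set)" and I: "lf l * f \<in> I"
  obtain m where m: "f - lf m \<in> I" using e_span f by blast
  have "lf l * (f - lf m) \<in> I" using m by (intro ideal_mult(1) forms_pcarrier[OF lf_form])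
  then have "lf l * f - lf l * lf m \<in> I" by (simp add: right_diff_distrib)
  then have "lf l * lf m \<in> I" using I ideal_cong by blast
  then have "lf l * lf m * lf v \<in> I" for v by (rule ideal_mult(2)[OF _ forms_pcarrier[OF lf_form]])
  then have "T l m v b = 0" for v b
    using F_ideal[of "lf l * lf m * lf v"] forms_mult[OF forms_mult[OF lf_form lf_form] lf_form, of l m v]
    by (simp add: T_def s numeral_3_eq_3)
  then have "m = 0" using T.injective_if_minor[OF D] by blast
  then show "f \<in> I" using m by simp
qed

text \<open>Degree 0 is injective for \<open>l \<noteq> 0\<close>, and from degree \<open>s\<close>
  on the target vanishes. There remain surjectivity onto the socle and, for \<open>s = 3\<close>,
  injectivity from degree 1 to degree 2; a product of two minors secures both at once.\<close>

lemma weak_lefschetz_socle_degree_le_3: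
  assumes "s \<le> 3"
  shows "weak_lefschetz A gr"
proof -
  obtain l1 h h' where l1: "pencil_minor h h' l1 \<noteq> 0"
    using exists_rank_two by (auto simp: pencil_minor_def)
  have nonzero: "l \<noteq> 0" if "pencil_minor h h' l \<noteq> 0" for l
    using that by (auto simp: pencil_minor_def)
  consider "s = 2" | "s = 3" using assms socle_degree_ge_2 by linarith
  then show ?thesis
  proof cases
    case 1
    have "maximal_rank A gr (cls (lf l)) i" if l: "pencil_minor h h' l \<noteq> 0" for l i
    proof -
      consider "i = 0" | "i = 1" | "i \<ge> s" using 1 by linarith
      then show ?thesis
        using maximal_rank_0[OF nonzero[OF l]] surjective_if_pencil_minor[OF l, of 1] 1
          maximal_rank_trivial[of i l] by cases simp_all
    qed
    then show ?thesis by (rule weak_lefschetz_if_polynomial[OF pencil_minor_coord_polys l1])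
  next
    case 2
    interpret T: cubic_pair T using 2 by (rule cubic_pair_T)
    obtain i j k l2 where l2: "T.minor i j k l2 \<noteq> 0" using T.exists_minor_nonzero by blast
    obtain l0 where l0: "pencil_minor h h' l0 \<noteq> 0 \<and> T.minor i j k l0 \<noteq> 0"
      using coord_polys_common_nonzero[OF pencil_minor_coord_polys T.minor_coord_polys l1 l2] by blast
    have "maximal_rank A gr (cls (lf l)) r" if "pencil_minor h h' l * T.minor i j k l \<noteq> 0" for l r
    proof -
      have l: "pencil_minor h h' l \<noteq> 0" "T.minor i j k l \<noteq> 0" using that by auto
      consider "r = 0" | "r = 1" | "r = 2" | "r \<ge> s" using 2 by linarith
      then show ?thesis
        using maximal_rank_0[OF nonzero[OF l(1)]] surjective_if_pencil_minor[OF l(1), of 2] 2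
          maximal_rank_1[OF 2 l(2)] maximal_rank_trivial[of r l] by cases simp_all
    qed
    then show ?thesis
      using weak_lefschetz_if_polynomial[OF coord_polys.mult[OF pencil_minor_coord_polys T.minor_coord_polys]] l0
      by (metis mult_eq_0_iff)
  qed
qed

end

lemma level_algebras_weak_lefschetz_3:
  "level_algebras_weak_lefschetz TYPE('k::field_char_0) 2 3 3"
proof -
  have "weak_lefschetz (polynomial_ring n Quot I) (quotient_grading n I)"
    if hom: "homogeneous_ideal n I" and codim: "codimension (polynomial_ring n Quot I) (quotient_grading n I) 3"
      and level: "level (polynomial_ring n Quot I) (quotient_grading n I) 2 s" and s: "s \<le> 3"
    for n s and I :: "'k mpoly set"
  proof -
    obtain e F where "level_coordinates n I s e F"
      by (rule level_coordinates_if_level[OF graded_quotient_if_homogeneous[OF hom] codim level])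
    then show ?thesis using s by (rule level_coordinates.weak_lefschetz_socle_degree_le_3)
  qed
  then show ?thesis unfolding level_algebras_weak_lefschetz_def Let_def
    by (metis of_nat_le_iff of_nat_numeral)
qed

section \<open>Artinian quotients\<close>

text \<open>The images under \<open>\<tau>\<close> of the preimages of the \<open>J i\<close> form a
  descending chain of subspaces of a finite-dimensional space, which becomes constant at minimal
  dimension. Since \<open>\<tau>\<close> vanishes only on elements of \<open>I\<close>, the chain
  \<open>J\<close> becomes constant there too.\<close>

lemma (in graded_quotient) artinian_if_finite_dimensional:
  fixes \<tau> :: "'k mpoly \<Rightarrow> 'k^'n"
  assumes add: "\<And>f g. \<tau> (f + g) = \<tau> f + \<tau> g"
    and scale: "\<And>c f. \<tau> (const c * f) = c *s \<tau> f"
    and ker: "\<And>f. f \<in> pcarrier n \<Longrightarrow> \<tau> f = 0 \<Longrightarrow> f \<in> I"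
  shows "artinian A"
  unfolding artinian_def
proof (intro allI impI)
  fix J :: "nat \<Rightarrow> 'k mpoly set set"
  assume J: "(\<forall>i. ideal (J i) A) \<and> (\<forall>i. J (Suc i) \<subseteq> J i)"
  then have ideal: "ideal (J i) A" and step: "J (Suc i) \<subseteq> J i" for i by auto
  have anti: "J j \<subseteq> J i" if "i \<le> j" for i j
    by (rule lift_Suc_antimono_le[of J, OF step that])
  define S where "S i = \<tau> ` {f \<in> pcarrier n. cls f \<in> J i}" for i
  have subspace: "vec.subspace (S i)" for i
  proof (rule vec.subspaceI)
    interpret Ji: ideal "J i" A by (rule ideal)
    have "\<tau> 0 = 0" using add[of 0 0] by simp
    moreover have "cls 0 \<in> J i" using Ji.zero_closed by (simp only: A_zero)
    ultimately show "0 \<in> S i" using pcarrier_closed(1) by (force simp: S_def)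
    show "x + y \<in> S i" if xy: "x \<in> S i" "y \<in> S i" for x y
    proof -
      obtain f g where f: "f \<in> pcarrier n" "cls f \<in> J i" "x = \<tau> f"
        and g: "g \<in> pcarrier n" "cls g \<in> J i" "y = \<tau> g" using xy by (auto simp: S_def)
      have "cls (f + g) \<in> J i" using Ji.a_closed[OF f(2) g(2)] f(1) g(1) by simp
      then show ?thesis unfolding S_def f(3) g(3) add[symmetric]
        using pcarrier_closed(2)[OF f(1) g(1)] by blast
    qed
    show "c *s x \<in> S i" if x: "x \<in> S i" for c x
    proof -
      obtain f where f: "f \<in> pcarrier n" "cls f \<in> J i" "x = \<tau> f" using x by (auto simp: S_def)
      have "cls (const c * f) \<in> J i"
        using Ji.I_l_closed[OF f(2) cls_closed[OF const_pcarrier[of c]]] f(1) by simp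
      then show ?thesis unfolding S_def f(3) scale[symmetric]
        using pcarrier_closed(3)[OF const_pcarrier f(1)] by blast
    qed
  qed
  obtain N where N: "\<And>i. vec.dim (S N) \<le> vec.dim (S i)"
    using ex_has_least_nat[of "\<lambda>_. True" 0 "\<lambda>i. vec.dim (S i)"] by auto
  have "J i = J N" if i: "i \<ge> N" for i
  proof
    show "J i \<subseteq> J N" using i by (rule anti)
    then have "S i \<subseteq> S N" by (auto simp: S_def)
    then have S: "S i = S N" using N[of i] by (intro vec.subspace_dim_equal subspace)
    show "J N \<subseteq> J i"
    proof
      fix x assume x: "x \<in> J N"
      then have "x \<in> carrier A" using ideal additive_subgroup.a_subset ideal.axioms(1) by blast
      then obtain f where f: "f \<in> pcarrier n" "x = cls f" using A_carrier by blast
      then have "\<tau> f \<in> S i" using x unfolding S by (auto simp: S_def)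
      then obtain g where g: "g \<in> pcarrier n" "cls g \<in> J i" "\<tau> f = \<tau> g" by (auto simp: S_def)
      have diff: "f - g = f + const (-1) * g" by (rule poly_mapping_eqI) (simp add: lookup_minus lookup_add)
      then have "\<tau> (f - g) = 0" by (simp only: diff add scale g(3)) simp
      moreover have "f - g \<in> pcarrier n"
        unfolding diff using f(1) g(1) by (intro pcarrier_closed(2,3) const_pcarrier)
      ultimately have "f - g \<in> I" using ker by blast
      then show "x \<in> J i" using cls_eq_iff[OF f(1) g(1)] f(2) g(2) by simp
    qed
  qed
  then show "\<exists>N. \<forall>i\<ge>N. J i = J N" by blast
qed

section \<open>A level algebra of socle degree four without the Weak Lefschetz Property\<close>

definition mon :: "nat \<Rightarrow> nat \<Rightarrow> nat \<Rightarrow> nat \<Rightarrow>\<^sub>0 nat" where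
  "mon i j k = Poly_Mapping.single 0 i + Poly_Mapping.single 1 j + Poly_Mapping.single 2 k"

lemma lookup_mon [simp]:
  "Poly_Mapping.lookup (mon i j k) 0 = i" "Poly_Mapping.lookup (mon i j k) (Suc 0) = j"
  "Poly_Mapping.lookup (mon i j k) 2 = k" "p > 2 \<Longrightarrow> Poly_Mapping.lookup (mon i j k) p = 0"
  by (simp_all add: mon_def lookup_add lookup_single)

lemma mon_eq_iff [simp]: "mon i j k = mon i' j' k' \<longleftrightarrow> i = i' \<and> j = j' \<and> k = k'"
  using lookup_mon(1-3) by metis

lemma mon_add: "mon i j k + mon i' j' k' = mon (i + i') (j + j') (k + k')"
  by (simp add: mon_def single_add add_ac)

lemma mon_total_degree [simp]: "total_degree (mon i j k) = i + j + k"
  by (simp add: mon_def)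

lemma mon_keys: "Poly_Mapping.keys (mon i j k) \<subseteq> {..<3}"
proof
  fix p assume "p \<in> Poly_Mapping.keys (mon i j k)"
  then show "p \<in> {..<3}" using lookup_mon(4)[of p i j k] by (cases "p > 2") (auto simp: in_keys_iff)
qed

lemma mon_cases:
  assumes "Poly_Mapping.keys m \<subseteq> {..<3}"
  shows "m = mon (Poly_Mapping.lookup m 0) (Poly_Mapping.lookup m 1) (Poly_Mapping.lookup m 2)"
proof (rule poly_mapping_eqI)
  fix p
  show "Poly_Mapping.lookup m p = Poly_Mapping.lookup
    (mon (Poly_Mapping.lookup m 0) (Poly_Mapping.lookup m 1) (Poly_Mapping.lookup m 2)) p"
  proof (cases "p > 2")
    case True
    then have "p \<notin> Poly_Mapping.keys m" using assms by auto
    then show ?thesis using True by (simp add: in_keys_iff)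
  next
    case False
    then consider "p = 0" | "p = 1" | "p = 2" by linarith
    then show ?thesis by cases simp_all
  qed
qed

abbreviation cf :: "'k::field mpoly \<Rightarrow> nat \<Rightarrow> nat \<Rightarrow> nat \<Rightarrow> 'k" where
  "cf f i j k \<equiv> Poly_Mapping.lookup f (mon i j k)"

definition X :: "nat \<Rightarrow> nat \<Rightarrow> nat \<Rightarrow> 'k::field mpoly" where
  "X i j k = Poly_Mapping.single (mon i j k) 1"

lemma X_mult: "X i j k * X i' j' k' = X (i + i') (j + j') (k + k')"
  by (simp add: X_def mult_single mon_add)

lemma X_forms: "i + j + k = d \<Longrightarrow> X i j k \<in> forms 3 d"
  using mon_keys by (simp add: X_def forms_iff pcarrier_iff)

lemma X_pcarrier [simp]: "X i j k \<in> pcarrier 3"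
  using X_forms forms_pcarrier by blast

lemma cf_X: "cf (X i j k) i' j' k' = (if i = i' \<and> j = j' \<and> k = k' then 1 else 0)"
  by (simp add: X_def lookup_single when_def)

lemma lookup_single_mult:
  "Poly_Mapping.lookup (Poly_Mapping.single m c * f) m' = c * (\<Sum>q. Poly_Mapping.lookup f q when m' = m + q)"
  for f :: "'k::field mpoly"
  by (simp add: lookup_mult lookup_single when_mult)

text \<open>Multiplication by a monomial shifts exponents; the guard excludes truncated differences
  of natural numbers.\<close>

lemma cf_X_mult:
  "cf (X a b c * f) i j k = (if a \<le> i \<and> b \<le> j \<and> c \<le> k then cf f (i - a) (j - b) (k - c) else 0)"
proof (cases "a \<le> i \<and> b \<le> j \<and> c \<le> k")
  case True
  then have "mon i j k = mon a b c + mon (i - a) (j - b) (k - c)" by (simp add: mon_add)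
  then show ?thesis using True by (simp add: X_def lookup_single_mult)
next
  case False
  have "mon i j k \<noteq> mon a b c + q" for q
  proof
    assume eq: "mon i j k = mon a b c + q"
    have "i = a + Poly_Mapping.lookup q 0" "j = b + Poly_Mapping.lookup q 1" "k = c + Poly_Mapping.lookup q 2"
      using arg_cong[OF eq, of "\<lambda>m. Poly_Mapping.lookup m 0"] arg_cong[OF eq, of "\<lambda>m. Poly_Mapping.lookup m 1"]
        arg_cong[OF eq, of "\<lambda>m. Poly_Mapping.lookup m 2"] by (simp_all add: lookup_add)
    then show False using False by auto
  qed
  then have "cf (X a b c * f) i j k = 0" by (simp add: X_def lookup_single_mult)
  then show ?thesis unfolding if_not_P[OF False] .
qed

lemma forms_3_eqI:
  assumes "f \<in> forms 3 d" "g \<in> forms 3 d" "\<And>i j k. i + j + k = d \<Longrightarrow> cf f i j k = cf g i j k"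
  shows "f = g"
proof (rule poly_mapping_eqI)
  fix m
  show "Poly_Mapping.lookup f m = Poly_Mapping.lookup g m"
  proof (cases "m \<in> Poly_Mapping.keys f \<union> Poly_Mapping.keys g")
    case True
    then have "Poly_Mapping.keys m \<subseteq> {..<3}" "total_degree m = d"
      using assms(1,2) by (auto simp: forms_iff pcarrier_iff)
    then show ?thesis using mon_cases assms(3) mon_total_degree by metis
  qed (simp add: in_keys_iff)
qed

lemma hcomp_mult_form:
  assumes g: "g \<in> forms n e" and f: "f \<in> pcarrier n"
  shows "hcomp d (g * f) = (if e \<le> d then g * hcomp (d - e) f else 0)"
proof -
  obtain N where N: "f = (\<Sum>a\<le>N. hcomp a f)" by (rule sum_hcomp)
  have "hcomp d (g * f) = (\<Sum>a\<le>N. hcomp d (g * hcomp a f))"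
    by (subst N) (simp add: sum_distrib_left hcomp_sum)
  also have "\<dots> = (\<Sum>a\<le>N. if e + a = d then g * hcomp a f else 0)"
    using hcomp_of_form[OF forms_mult[OF g hcomp_forms[OF f]]] by (intro sum.cong) auto
  also have "\<dots> = (if e \<le> d then g * (\<Sum>a\<le>N. if a = d - e then hcomp a f else 0) else 0)"
  proof (cases "e \<le> d")
    case True
    then have "e + a = d \<longleftrightarrow> a = d - e" for a by auto
    then show ?thesis using True by simp
  qed auto
  also have "(\<Sum>a\<le>N. if a = d - e then hcomp a f else 0) = (\<Sum>a\<le>N. hcomp (d - e) (hcomp a f))"
    using hcomp_of_form[OF hcomp_forms[OF f]] by (intro sum.cong) auto
  also have "\<dots> = hcomp (d - e) f" by (simp only: hcomp_sum[symmetric] N[symmetric])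
  finally show ?thesis .
qed

text \<open>The two quartic functionals generate the inverse system of the counterexample: they are the
  divided powers \<open>X\<^sup>2Y\<^sup>2 - Y\<^sup>2Z\<^sup>2\<close> and \<open>X\<^sup>2Z\<^sup>2 - Y\<^sup>2Z\<^sup>2\<close>.\<close>

definition quartic :: "bool \<Rightarrow> 'k::field mpoly \<Rightarrow> 'k" where
  "quartic b f = (if b then cf f 2 2 0 else cf f 2 0 2) - cf f 0 2 2"

text \<open>Macaulay's annihilator of an inverse system, with polynomials paired through
  coefficients; testing all multiples \<open>g * f\<close> makes the set an ideal.\<close>

definition apolar_ideal :: "'k::field mpoly set" where
  "apolar_ideal = {f \<in> pcarrier 3. \<forall>g\<in>pcarrier 3. \<forall>b. quartic b (g * f) = 0}"

lemma quartic_add: "quartic b (f + g) = quartic b f + quartic b g"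
  by (simp add: quartic_def lookup_add)

lemma quartic_diff: "quartic b (f - g) = quartic b f - quartic b g"
  by (simp add: quartic_def lookup_minus)

lemma quartic_const_mult [simp]: "quartic b (const c * f) = c * quartic b f"
  by (cases b) (simp_all add: quartic_def right_diff_distrib)

lemma quartic_0 [simp]: "quartic b 0 = 0"
  by (simp add: quartic_def)

lemma quartic_hcomp: "quartic b (hcomp d f) = (if d = 4 then quartic b f else 0)"
  by (simp add: quartic_def)

lemma quartic_forms: "f \<in> forms n d \<Longrightarrow> d \<noteq> 4 \<Longrightarrow> quartic b f = 0"
  using quartic_hcomp[of b d f] hcomp_of_form[of f n d d] by simp

lemma apolar_idealI:
  assumes f: "f \<in> pcarrier 3" and zero: "\<And>i j k b. quartic b (X i j k * f) = 0"
  shows "f \<in> apolar_ideal"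
proof -
  have "\<forall>b. quartic b (g * f) = 0" if "g \<in> pcarrier 3" for g
    using that
  proof (induction g rule: monomial_induct)
    case (monomial m c)
    then have "m = mon (Poly_Mapping.lookup m 0) (Poly_Mapping.lookup m 1) (Poly_Mapping.lookup m 2)"
      using that by (intro mon_cases) (auto simp: pcarrier_iff)
    then obtain i j k where m: "m = mon i j k" by blast
    have "Poly_Mapping.single m c = const c * X i j k" by (simp add: m X_def mult_single)
    then show ?case by (simp add: mult.assoc zero)
  qed (auto simp: distrib_right quartic_add)
  then show ?thesis using f by (simp add: apolar_ideal_def)
qed

lemma apolar_idealD: "f \<in> apolar_ideal \<Longrightarrow> quartic b (X i j k * f) = 0"
  by (simp add: apolar_ideal_def)

text \<open>\<open>quartic\<close> sees only degree four, so selecting degree \<open>d\<close> in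
  one factor amounts to selecting degree \<open>4 - d\<close> in the other. This is why
  \<open>apolar_ideal\<close> is homogeneous.\<close>

lemma quartic_mult_hcomp:
  assumes g: "g \<in> pcarrier n" and f: "f \<in> pcarrier n"
  shows "quartic b (g * hcomp d f) = (if d \<le> 4 then quartic b (hcomp (4 - d) g * f) else 0)"
proof -
  have "quartic b (g * hcomp d f) = quartic b (hcomp 4 (hcomp d f * g))"
    by (simp add: quartic_hcomp mult.commute)
  also have "\<dots> = (if d \<le> 4 then quartic b (hcomp 4 (hcomp (4 - d) g * f)) else 0)"
    using hcomp_mult_form[OF hcomp_forms[OF f] g] hcomp_mult_form[OF hcomp_forms[OF g] f]
    by (simp add: mult.commute)
  finally show ?thesis by (simp add: quartic_hcomp)
qed

lemma apolar_graded_quotient: "graded_quotient 3 (apolar_ideal :: 'k::field mpoly set)"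
proof (rule graded_quotient.intro)
  interpret R: cring "polynomial_ring 3 :: 'k mpoly ring" by (rule polynomial_ring_cring)
  show "ideal apolar_ideal (polynomial_ring 3 :: 'k mpoly ring)"
  proof (rule idealI)
    show "ring (polynomial_ring 3 :: 'k mpoly ring)" by (rule R.ring_axioms)
    have mult: "x * a \<in> apolar_ideal" if "a \<in> apolar_ideal" "x \<in> pcarrier 3" for a x :: "'k mpoly"
      using that pcarrier_closed(3) by (auto simp: apolar_ideal_def simp flip: mult.assoc)
    then show "x \<otimes>\<^bsub>polynomial_ring 3\<^esub> a \<in> apolar_ideal" "a \<otimes>\<^bsub>polynomial_ring 3\<^esub> x \<in> apolar_ideal"
      if "a \<in> apolar_ideal" "x \<in> pcarrier 3" for a x :: "'k mpoly"
      using mult[OF that] by (simp_all add: mult.commute)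
    show "subgroup (apolar_ideal :: 'k mpoly set) (add_monoid (polynomial_ring 3))"
    proof (rule R.add.subgroupI)
      show "apolar_ideal \<subseteq> pcarrier 3" by (auto simp: apolar_ideal_def)
      show "(apolar_ideal :: 'k mpoly set) \<noteq> {}"
        using pcarrier_closed(1) by (auto simp: apolar_ideal_def intro!: exI[of _ 0])
      show "\<ominus>\<^bsub>polynomial_ring 3\<^esub> a \<in> apolar_ideal" if a: "a \<in> apolar_ideal" for a :: "'k mpoly"
      proof -
        have ac: "a \<in> pcarrier 3" using a by (simp add: apolar_ideal_def)
        have "const (-1) * a \<in> apolar_ideal" by (rule mult[OF a const_pcarrier])
        moreover have "\<ominus>\<^bsub>polynomial_ring 3\<^esub> a = - a"
          using R.r_neg[OF ac] by (simp add: eq_neg_iff_add_eq_0 add.commute)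
        ultimately show ?thesis by (simp add: single_uminus)
      qed
      show "a \<oplus>\<^bsub>polynomial_ring 3\<^esub> b \<in> apolar_ideal"
        if "a \<in> apolar_ideal" "b \<in> apolar_ideal" for a b :: "'k mpoly"
        using that by (simp add: apolar_ideal_def pcarrier_closed distrib_left quartic_add)
    qed
  qed
  show "hcomp d f \<in> apolar_ideal" if f: "f \<in> apolar_ideal" for f :: "'k mpoly" and d
  proof -
    have fc: "f \<in> pcarrier 3" and zero: "\<And>g b. g \<in> pcarrier 3 \<Longrightarrow> quartic b (g * f) = 0"
      using f by (simp_all add: apolar_ideal_def)
    have "quartic b (g * hcomp d f) = 0" if g: "g \<in> pcarrier 3" for g b
      using zero[OF forms_pcarrier[OF hcomp_forms[OF g]]] by (simp add: quartic_mult_hcomp[OF g fc])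
    then show ?thesis using forms_pcarrier[OF hcomp_forms[OF fc]] by (simp add: apolar_ideal_def)
  qed
qed

text \<open>A multiplier of positive degree pushes \<open>f\<close> beyond degree four, where
  \<open>quartic\<close> vanishes; only the multiplier 1 counts.\<close>

lemma apolar_forms_iff:
  fixes f :: "'k::field mpoly"
  assumes f: "f \<in> forms 3 d" and d: "d \<ge> 4"
  shows "f \<in> apolar_ideal \<longleftrightarrow> (\<forall>b. quartic b f = 0)"
proof
  assume "f \<in> apolar_ideal"
  moreover have "X 0 0 0 = (1 :: 'k mpoly)" by (simp add: X_def mon_def)
  ultimately show "\<forall>b. quartic b f = 0" using apolar_idealD[of f _ 0 0 0] by simp
next
  assume zero: "\<forall>b. quartic b f = 0"
  show "f \<in> apolar_ideal"
  proof (rule apolar_idealI)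
    show "f \<in> pcarrier 3" using f by (rule forms_pcarrier)
    show "quartic b (X i j k * f) = 0" for i j k b
    proof (cases "i + j + k = 0")
      case True
      then have "X i j k = (1 :: 'k mpoly)" by (simp add: X_def mon_def)
      then show ?thesis using zero by simp
    next
      case False
      then show ?thesis using forms_mult[OF X_forms[OF refl] f] d by (intro quartic_forms) auto
    qed
  qed
qed

lemma apolar_top: "d > 4 \<Longrightarrow> forms 3 d \<subseteq> apolar_ideal"
  using apolar_forms_iff quartic_forms by (metis less_imp_le nat_neq_iff subsetI)

section \<open>The counterexample is artinian and level, of codimension three and type two\<close>

locale apolar_quotient = graded_quotient 3 "apolar_ideal :: 'k::field mpoly set"
begin

text \<open>A representative \<open>f\<close> of a socle element is congruent to its component of
  degree four: against 1 both have the same values under \<open>quartic\<close>, and against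
  monomials of positive degree both give zero.\<close>

lemma apolar_socle: "socle A gr = gr 4"
proof
  show "socle A gr \<subseteq> gr 4"
  proof
    fix x :: "'k mpoly set" assume x: "x \<in> socle A gr"
    then obtain f where f: "f \<in> pcarrier 3" "x = cls f" unfolding socle_def A_carrier by blast
    have ann: "g * f \<in> apolar_ideal" if "g \<in> forms 3 i" "i \<ge> 1" for g i
    proof -
      have "cls g \<otimes>\<^bsub>A\<^esub> x = \<zero>\<^bsub>A\<^esub>"
        using x that unfolding socle_def gr_def by blast
      then show ?thesis
        using f forms_pcarrier[OF that(1)] by (simp add: cls_eq_zero_iff pcarrier_closed(3))
    qed
    note f4 = hcomp_forms[OF f(1), of 4]
    have diff: "f - hcomp 4 f \<in> pcarrier 3"
      using pcarrier_closed(2)[OF f(1) pcarrier_closed(3)[OF const_pcarrier forms_pcarrier[OF f4]], of "-1"]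
      by (simp add: single_uminus)
    have "f - hcomp 4 f \<in> apolar_ideal"
    proof (rule apolar_idealI[OF diff])
      fix i j k b
      show "quartic b (X i j k * (f - hcomp 4 f)) = 0"
      proof (cases "i + j + k = 0")
        case True
        then have "X i j k = (1 :: 'k mpoly)" by (simp add: X_def mon_def)
        then show ?thesis by (simp add: quartic_diff quartic_hcomp)
      next
        case False
        have "X i j k * f \<in> apolar_ideal" using False by (intro ann[OF X_forms[OF refl]]) linarith
        then have "quartic b (X i j k * f) = 0" using apolar_idealD[of _ b 0 0 0] by (simp add: X_def mon_def)
        moreover have "quartic b (X i j k * hcomp 4 f) = 0"
          using forms_mult[OF X_forms[OF refl] f4] False by (intro quartic_forms) auto
        ultimately show ?thesis by (simp add: right_diff_distrib quartic_diff)
      qed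
    qed
    then have "x = cls (hcomp 4 f)" using cls_eq_iff f forms_pcarrier[OF f4] by blast
    then show "x \<in> gr 4" using f4 by (simp add: gr_def)
  qed
  show "gr 4 \<subseteq> socle A gr"
  proof
    fix x :: "'k mpoly set" assume "x \<in> gr 4"
    then obtain f where f: "f \<in> forms 3 4" "x = cls f" by (auto simp: gr_def)
    have "cls g \<otimes>\<^bsub>A\<^esub> x = \<zero>\<^bsub>A\<^esub>" if g: "g \<in> forms 3 i" and i: "i \<ge> 1" for g i
    proof -
      have "g * f \<in> apolar_ideal" using forms_mult[OF g f(1)] apolar_top[of "i + 4"] i by auto
      then show ?thesis
        using f forms_pcarrier[OF g] forms_pcarrier[OF f(1)] by (simp add: cls_eq_zero_iff pcarrier_closed(3))
    qed
    then show "x \<in> socle A gr"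
      using f cls_closed[OF forms_pcarrier[OF f(1)]] by (auto simp: socle_def gr_def)
  qed
qed

lemma quartic_X: "quartic b (X 2 2 0) = (if b then 1 else 0)" "quartic b (X 2 0 2) = (if b then 0 else 1)"
  by (simp_all add: quartic_def cf_X)

text \<open>By \<open>quartic_X\<close>, the two monomials are dual to the two quartic functionals,
  so their classes form a basis of degree four.\<close>

lemma apolar_level: "level A gr 2 4"
proof -
  define v :: "nat \<Rightarrow> 'k mpoly" where "v i = (if i = 0 then X 2 2 0 else X 2 0 2)" for i
  have lin: "lin v 2 c = const (c 0) * X 2 2 0 + const (c 1) * X 2 0 2" for c
    by (simp add: lin_def v_def numeral_2_eq_2)
  have v: "X 2 2 0 \<in> forms 3 4" "X 2 0 2 \<in> forms 3 4" by (simp_all add: X_forms)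
  have lin_forms: "lin v 2 c \<in> forms 3 4" for c
    unfolding lin using v by (intro forms_add forms_const_mult)
  have quartic_lin: "quartic b (lin v 2 c) = (if b then c 0 else c 1)" for b c
    by (simp add: lin quartic_add quartic_X)
  have "A.dimension 2 (gr 0) (range (\<lambda>c. cls (lin v 2 c)))"
  proof (rule dimension_intro)
    show "v i \<in> pcarrier 3" for i by (simp add: v_def)
    show "\<forall>i<2. c i = 0" if "lin v 2 c \<in> apolar_ideal" for c
      using that apolar_forms_iff[OF lin_forms] quartic_lin[of _ c]
      by (auto simp: less_2_cases_iff all_bool_eq)
  qed
  also have "range (\<lambda>c. cls (lin v 2 c)) = gr 4"
  proof
    show "range (\<lambda>c. cls (lin v 2 c)) \<subseteq> gr 4"
      using lin_forms by (auto simp: gr_def)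
    show "gr 4 \<subseteq> range (\<lambda>c. cls (lin v 2 c))"
    proof
      fix x assume "x \<in> gr 4"
      then obtain f where f: "f \<in> forms 3 4" "x = cls f" by (auto simp: gr_def)
      define c where "c i = quartic (i = 0) f" for i :: nat
      have "f - lin v 2 c \<in> apolar_ideal"
        using apolar_forms_iff[OF forms_diff[OF f(1) lin_forms]]
        by (simp add: quartic_diff quartic_lin c_def)
      then have "x = cls (lin v 2 c)"
        using f cls_eq_iff[OF forms_pcarrier[OF f(1)] forms_pcarrier[OF lin_forms]] by blast
      then show "x \<in> range (\<lambda>c. cls (lin v 2 c))" by blast
    qed
  qed
  finally have "A.dimension 2 (gr 0) (gr 4)" .
  moreover have "X 2 2 0 \<notin> (apolar_ideal :: 'k mpoly set)"
    using apolar_forms_iff[OF v(1)] by (auto simp: quartic_X all_bool_eq)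
  then have "gr 4 \<noteq> {\<zero>\<^bsub>A\<^esub>}"
    using v(1) unfolding gr_eq_zero_iff by blast
  moreover have "gr d = {\<zero>\<^bsub>A\<^esub>}" if "d > 4" for d
    using apolar_top[OF that] unfolding gr_eq_zero_iff .
  ultimately show ?thesis by (simp add: level_def socle_degree_def apolar_socle)
qed

text \<open>Multiplying by a complementary monomial moves each coefficient to a place that
  \<open>quartic\<close> reads; where two coefficients arrive together, another instance eliminates
  one of them.\<close>

lemma apolar_coefficients:
  assumes "f \<in> apolar_ideal"
  shows "cf f 1 0 0 = 0" "cf f 0 1 0 = 0" "cf f 0 0 1 = 0"
    and "cf f 2 0 0 = 0" "cf f 0 2 0 = 0" "cf f 0 0 2 = 0" "cf f 1 1 0 = 0"
    and "cf f 1 2 0 = 0" "cf f 1 0 2 = 0" "cf f 2 1 0 = 0" "cf f 0 1 2 = 0" "cf f 2 0 1 = 0" "cf f 0 2 1 = 0"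
  using apolar_idealD[OF assms, of True 1 2 0] apolar_idealD[OF assms, of True 2 1 0]
    apolar_idealD[OF assms, of False 2 0 1] apolar_idealD[OF assms, of True 0 2 0]
    apolar_idealD[OF assms, of True 2 0 0] apolar_idealD[OF assms, of False 2 0 0]
    apolar_idealD[OF assms, of True 1 1 0] apolar_idealD[OF assms, of True 1 0 0]
    apolar_idealD[OF assms, of False 1 0 0] apolar_idealD[OF assms, of True 0 1 0]
    apolar_idealD[OF assms, of False 0 1 0] apolar_idealD[OF assms, of True 0 0 1]
    apolar_idealD[OF assms, of False 0 0 1]
  by (simp_all add: quartic_def cf_X_mult)

definition linear3 :: "'k::field \<Rightarrow> 'k \<Rightarrow> 'k \<Rightarrow> 'k mpoly" where
  "linear3 a b c = const a * X 1 0 0 + const b * X 0 1 0 + const c * X 0 0 1"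

lemma linear3_forms: "linear3 a b c \<in> forms 3 1"
  unfolding linear3_def by (intro forms_add forms_const_mult X_forms) simp_all

lemma forms_1_linear3:
  assumes "f \<in> forms 3 1"
  shows "f = linear3 (cf f 1 0 0) (cf f 0 1 0) (cf f 0 0 1)"
proof (rule forms_3_eqI[OF assms linear3_forms])
  fix i j k :: nat assume "i + j + k = 1"
  then consider "i = 1 \<and> j = 0 \<and> k = 0" | "i = 0 \<and> j = 1 \<and> k = 0" | "i = 0 \<and> j = 0 \<and> k = 1"
    by linarith
  then show "cf f i j k = cf (linear3 (cf f 1 0 0) (cf f 0 1 0) (cf f 0 0 1)) i j k"
    by cases (simp_all add: linear3_def lookup_add cf_X)
qed

lemma apolar_codimension: "codimension A gr 3"
proof -
  define v :: "nat \<Rightarrow> 'k mpoly" where "v i = (if i = 0 then X 1 0 0 else if i = 1 then X 0 1 0 else X 0 0 1)" for i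
  have lin: "lin v 3 c = linear3 (c 0) (c 1) (c 2)" for c
    by (simp add: lin_def v_def linear3_def numeral_3_eq_3 numeral_2_eq_2)
  have "A.dimension 3 (gr 0) (range (\<lambda>c. cls (lin v 3 c)))"
  proof (rule dimension_intro)
    show "v i \<in> pcarrier 3" for i by (simp add: v_def)
    show "\<forall>i<3. c i = 0" if I: "lin v 3 c \<in> apolar_ideal" for c
    proof -
      have "c 0 = 0 \<and> c 1 = 0 \<and> c 2 = 0"
        using apolar_coefficients(1-3)[OF I] by (simp add: lin linear3_def lookup_add cf_X)
      then show ?thesis by (auto simp: numeral_3_eq_3 numeral_2_eq_2 less_Suc_eq)
    qed
  qed
  also have "range (\<lambda>c. cls (lin v 3 c)) = gr 1"
  proof
    show "range (\<lambda>c. cls (lin v 3 c)) \<subseteq> gr 1"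
      using linear3_forms by (auto simp: gr_def lin)
    show "gr 1 \<subseteq> range (\<lambda>c. cls (lin v 3 c))"
    proof
      fix x assume "x \<in> gr 1"
      then obtain f where f: "f \<in> forms 3 1" "x = cls f" by (auto simp: gr_def)
      define c where "c i = (if i = 0 then cf f 1 0 0 else if i = 1 then cf f 0 1 0 else cf f 0 0 1)" for i :: nat
      have "f = lin v 3 c" using forms_1_linear3[OF f(1)] by (simp add: lin c_def)
      then show "x \<in> range (\<lambda>c. cls (lin v 3 c))" using f(2) by blast
    qed
  qed
  finally show ?thesis by (simp add: codimension_def)
qed

text \<open>Only coefficients with all exponents at most two can enter \<open>quartic\<close> after
  multiplication by a monomial, so 27 coefficients decide membership. \<open>ex\<close> shifts the
  indices 1, 2, 3 to the exponents 0, 1, 2.\<close>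

lemma apolar_artinian: "artinian A"
proof -
  define ex :: "3 \<Rightarrow> nat" where "ex p = (if p = 1 then 0 else if p = 2 then 1 else 2)" for p
  have ex: "\<exists>p. i = ex p" if "i \<le> 2" for i
  proof -
    have "i = 0 \<or> i = 1 \<or> i = 2" using that by linarith
    moreover have "ex 1 = 0" "ex 2 = 1" "ex 3 = 2" by (simp_all add: ex_def)
    ultimately show ?thesis by metis
  qed
  define \<tau> :: "'k mpoly \<Rightarrow> 'k^(3 \<times> 3 \<times> 3)" where
    "\<tau> f = (\<chi> p. cf f (ex (fst p)) (ex (fst (snd p))) (ex (snd (snd p))))" for f
  show ?thesis
  proof (rule artinian_if_finite_dimensional[of \<tau>])
    show "\<tau> (f + g) = \<tau> f + \<tau> g" for f g by (simp add: \<tau>_def vec_eq_iff lookup_add)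
    show "\<tau> (const c * f) = c *s \<tau> f" for c f by (simp add: \<tau>_def vec_eq_iff)
    show "f \<in> apolar_ideal" if f: "f \<in> pcarrier 3" and 0: "\<tau> f = 0" for f
    proof (rule apolar_idealI[OF f])
      have "cf f i j k = 0" if "i \<le> 2" "j \<le> 2" "k \<le> 2" for i j k
      proof -
        obtain p where "i = ex p" using ex \<open>i \<le> 2\<close> by blast
        moreover obtain q where "j = ex q" using ex \<open>j \<le> 2\<close> by blast
        moreover obtain r where "k = ex r" using ex \<open>k \<le> 2\<close> by blast
        ultimately show ?thesis using arg_cong[OF 0, of "\<lambda>v. v $ (p, q, r)"] by (simp add: \<tau>_def)
      qed
      then show "quartic b (X i j k * f) = 0" for i j k b
        by (simp add: quartic_def cf_X_mult)
    qed
  qed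
qed

section \<open>Failure of maximal rank from degree two to degree three\<close>

lemma X_apolar:
  assumes "i \<ge> 3 \<or> j \<ge> 3 \<or> k \<ge> 3 \<or> (i \<ge> 1 \<and> j \<ge> 1 \<and> k \<ge> 1)"
  shows "X i j k \<in> (apolar_ideal :: 'k mpoly set)"
  \<comment> \<open>No multiple of such a monomial is one of the three monomials that
    \<open>quartic\<close> reads.\<close>
  using assms by (intro apolar_idealI) (auto simp: X_mult quartic_def cf_X)

text \<open>With \<open>p = ax\<close>, \<open>q = by\<close>, \<open>r = cz\<close>, the linear form \<open>p + q + r\<close> divides
  \<open>p\<^sup>3 + q\<^sup>3 + r\<^sup>3 - 3pqr\<close>, which lies in the ideal.\<close>

lemma apolar_not_injective:
  fixes a b c :: "'k"
  shows "\<exists>f\<in>forms 3 2. f \<notin> apolar_ideal \<and> linear3 a b c * f \<in> apolar_ideal"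
proof (cases "a = 0 \<and> b = 0 \<and> c = 0")
  case True
  \<comment> \<open>The zero form annihilates everything, so any non-zero class of degree two is a
    witness.\<close>
  then have "linear3 a b c * X 1 1 0 \<in> apolar_ideal" by (simp add: linear3_def)
  moreover have "X 1 1 0 \<notin> (apolar_ideal :: 'k mpoly set)"
    using apolar_coefficients(7)[of "X 1 1 0 :: 'k mpoly"] by (auto simp: cf_X)
  moreover have "X 1 1 0 \<in> forms 3 2" by (simp add: X_forms)
  ultimately show ?thesis by blast
next
  case False
  define p q r :: "'k mpoly" where pqr: "p = const a * X 1 0 0" "q = const b * X 0 1 0" "r = const c * X 0 0 1"
  define f where "f = p * p + q * q + r * r - p * q - q * r - r * p"
  have pqr_forms: "p \<in> forms 3 1" "q \<in> forms 3 1" "r \<in> forms 3 1"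
    unfolding pqr by (intro forms_const_mult X_forms; simp)+
  have two: "u * v \<in> forms 3 2" if "u \<in> forms 3 1" "v \<in> forms 3 1" for u v :: "'k mpoly"
    using forms_mult[OF that] by (simp add: numeral_2_eq_2)
  have "f \<in> forms 3 2" unfolding f_def by (intro forms_diff forms_add two pqr_forms)
  moreover have "linear3 a b c * f \<in> apolar_ideal"
  proof -
    have "linear3 a b c = p + q + r" by (simp add: linear3_def pqr)
    then have "linear3 a b c * f = p * p * p + q * q * q + r * r * r - const 3 * (p * q * r)"
      by (simp add: f_def algebra_simps)
    moreover have "p * p * p = const (a * a * a) * X 3 0 0" "q * q * q = const (b * b * b) * X 0 3 0"
      "r * r * r = const (c * c * c) * X 0 0 3" "p * q * r = const (a * b * c) * X 1 1 1"
      by (simp_all add: pqr X_def mult_single mon_add numeral_3_eq_3)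
    ultimately show ?thesis
      by (simp only:) (intro ideal_diff ideal_add ideal_const_mult X_apolar; simp)
  qed
  moreover have "f \<notin> apolar_ideal"
  proof
    assume "f \<in> apolar_ideal"
    note coeff = apolar_coefficients(4-6)[OF this]
    have "f = const (a * a) * X 2 0 0 + const (b * b) * X 0 2 0 + const (c * c) * X 0 0 2
      - const (a * b) * X 1 1 0 - const (b * c) * X 0 1 1 - const (c * a) * X 1 0 1"
      by (simp add: f_def pqr X_def mult_single mon_add numeral_2_eq_2)
    then have "a * a = 0" "b * b = 0" "c * c = 0"
      using coeff by (simp_all add: lookup_add lookup_minus cf_X)
    then show False using False by simp
  qed
  ultimately show ?thesis by blast
qed

text \<open>The cokernel of the multiplication is detected by the functional \<open>\<phi>\<close>, which is non-zero
  unless two of the coefficients vanish.\<close>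

lemma apolar_not_surjective:
  fixes a b c :: "'k"
  shows "\<exists>t\<in>forms 3 3. \<forall>g. t - linear3 a b c * g \<notin> apolar_ideal"
proof (rule ccontr)
  assume "\<not> ?thesis"
  then have surj: "\<exists>g. t - linear3 a b c * g \<in> apolar_ideal" if "t \<in> forms 3 3" for t
    using that by blast
  \<comment> \<open>The six cubic monomials in exactly two variables have vanishing coefficients on
    the ideal. Comparing these coefficients turns surjectivity into a 6 x 6 linear system in the
    quadratic coefficients of \<open>g\<close>.\<close>
  have coeffs: "\<exists>g.
    cf t 1 2 0 = a * cf g 0 2 0 + b * cf g 1 1 0 \<and> cf t 2 1 0 = a * cf g 1 1 0 + b * cf g 2 0 0 \<and>
    cf t 1 0 2 = a * cf g 0 0 2 + c * cf g 1 0 1 \<and> cf t 2 0 1 = a * cf g 1 0 1 + c * cf g 2 0 0 \<and>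
    cf t 0 1 2 = b * cf g 0 0 2 + c * cf g 0 1 1 \<and> cf t 0 2 1 = b * cf g 0 1 1 + c * cf g 0 2 0" if t: "t \<in> forms 3 3" for t
  proof -
    obtain g where g: "t - linear3 a b c * g \<in> apolar_ideal" using surj t by blast
    have "linear3 a b c * g = const a * (X 1 0 0 * g) + const b * (X 0 1 0 * g) + const c * (X 0 0 1 * g)"
      by (simp add: linear3_def algebra_simps)
    then have "cf (linear3 a b c * g) i j k = a * cf (X 1 0 0 * g) i j k + b * cf (X 0 1 0 * g) i j k
      + c * cf (X 0 0 1 * g) i j k" for i j k by (simp add: lookup_add)
    then have "cf t i j k = a * cf (X 1 0 0 * g) i j k + b * cf (X 0 1 0 * g) i j k
      + c * cf (X 0 0 1 * g) i j k" if "cf (t - linear3 a b c * g) i j k = 0" for i j k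
      using that by (simp add: lookup_minus)
    from this[OF apolar_coefficients(8)[OF g]] this[OF apolar_coefficients(9)[OF g]]
      this[OF apolar_coefficients(10)[OF g]] this[OF apolar_coefficients(11)[OF g]]
      this[OF apolar_coefficients(12)[OF g]] this[OF apolar_coefficients(13)[OF g]]
    show ?thesis by (intro exI[of _ g]) (simp add: cf_X_mult)
  qed
  \<comment> \<open>The weights are the coefficients of the product of \<open>X/a - Y/b\<close>,
    \<open>X/a - Z/c\<close> and \<open>Y/b - Z/c\<close>, cleared of denominators by
    \<open>a^2 b^2 c^2\<close>. They form a linear relation among the rows of the system.\<close>
  define \<phi> where "\<phi> t = b * c * c * cf t 2 1 0 - b * b * c * cf t 2 0 1 - a * c * c * cf t 1 2 0
    + a * a * c * cf t 0 2 1 + a * b * b * cf t 1 0 2 - a * a * b * cf t 0 1 2" for t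
  have "\<phi> t = 0" if t: "t \<in> forms 3 3" for t
  proof -
    obtain g where
      "cf t 1 2 0 = a * cf g 0 2 0 + b * cf g 1 1 0 \<and> cf t 2 1 0 = a * cf g 1 1 0 + b * cf g 2 0 0 \<and>
      cf t 1 0 2 = a * cf g 0 0 2 + c * cf g 1 0 1 \<and> cf t 2 0 1 = a * cf g 1 0 1 + c * cf g 2 0 0 \<and>
      cf t 0 1 2 = b * cf g 0 0 2 + c * cf g 0 1 1 \<and> cf t 0 2 1 = b * cf g 0 1 1 + c * cf g 0 2 0"
      using coeffs[OF t] ..
    then show ?thesis unfolding \<phi>_def by (simp only:) (simp add: algebra_simps)
  qed
  note phi = this[OF X_forms]
  have "b * c * c = 0" "b * b * c = 0" "a * c * c = 0" "a * a * c = 0" "a * b * b = 0" "a * a * b = 0"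
    using phi[of 2 1 0] phi[of 2 0 1] phi[of 1 2 0] phi[of 0 2 1] phi[of 1 0 2] phi[of 0 1 2]
    by (simp_all add: \<phi>_def cf_X)
  \<comment> \<open>With at most one variable left in the linear form, a cubic monomial in the other
    two is missed: its equation would read 1 = 0.\<close>
  then consider "b = 0 \<and> c = 0" | "a = 0 \<and> c = 0" | "a = 0 \<and> b = 0" by auto
  then show False
    using coeffs[OF X_forms, of 0 2 1] coeffs[OF X_forms, of 2 0 1] coeffs[OF X_forms, of 2 1 0]
    by cases (auto simp: cf_X)
qed

text \<open>Every linear form is neither injective nor surjective on degree two, so a single element
  of the non-empty set \<open>U\<close> gives the contradiction.\<close>

lemma apolar_not_weak_lefschetz:
  "\<not> weak_lefschetz A gr"
proof
  assume "weak_lefschetz A gr"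
  then obtain U where U: "zariski_open A (gr 0) (gr 1) U \<and> U \<noteq> {} \<and>
    (\<forall>L\<in>U. \<forall>i. maximal_rank A gr L i)"
    unfolding weak_lefschetz_def ..
  then have rank: "\<forall>L\<in>U. \<forall>i. maximal_rank A gr L i" by simp
  from U obtain L where "L \<in> U" by auto
  moreover have "U \<subseteq> gr 1" using U by (auto simp: zariski_open_def)
  ultimately have L: "L \<in> U" "L \<in> gr 1" by auto
  then obtain f where f: "f \<in> forms 3 1" "L = cls f" by (auto simp: gr_def)
  obtain a b c where "f = linear3 a b c" using forms_1_linear3[OF f(1)] by blast
  then have L_eq: "L = cls (linear3 a b c)" using f(2) by simp
  note lc = forms_pcarrier[OF linear3_forms[of a b c]]
  have "\<not> inj_on (\<lambda>x. L \<otimes>\<^bsub>A\<^esub> x) (gr 2)"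
  proof
    assume inj: "inj_on (\<lambda>x. L \<otimes>\<^bsub>A\<^esub> x) (gr 2)"
    obtain q where q: "q \<in> forms 3 2" "q \<notin> apolar_ideal" "linear3 a b c * q \<in> apolar_ideal"
      using apolar_not_injective by blast
    have "L \<otimes>\<^bsub>A\<^esub> cls q = L \<otimes>\<^bsub>A\<^esub> cls 0"
      using q lc forms_pcarrier[OF q(1)] pcarrier_closed(1)
      by (simp add: L_eq cls_eq_iff pcarrier_closed)
    then have "cls q = cls 0"
      using inj q(1) by (auto simp: gr_def dest: inj_onD)
    then show False using q(2) cls_eq_iff[OF forms_pcarrier[OF q(1)] pcarrier_closed(1)] by simp
  qed
  moreover have "(\<lambda>x. L \<otimes>\<^bsub>A\<^esub> x) ` gr 2 \<noteq> gr (Suc 2)"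
  proof
    assume surj: "(\<lambda>x. L \<otimes>\<^bsub>A\<^esub> x) ` gr 2 = gr (Suc 2)"
    obtain t where t: "t \<in> forms 3 3" "\<And>g. t - linear3 a b c * g \<notin> apolar_ideal"
      using apolar_not_surjective by blast
    have "cls t \<in> gr (Suc 2)" using imageI[OF t(1), of cls] by (simp add: gr_def)
    then obtain g where g: "g \<in> forms 3 2" "cls t = L \<otimes>\<^bsub>A\<^esub> cls g"
      unfolding surj[symmetric] by (auto simp: gr_def)
    then have "t - linear3 a b c * g \<in> apolar_ideal"
      using lc forms_pcarrier[OF g(1)] forms_pcarrier[OF t(1)]
      by (simp add: L_eq cls_eq_iff pcarrier_closed(3))
    then show False using t(2) by blast
  qed
  ultimately show False using rank L(1) unfolding maximal_rank_def by blast
qed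

lemma not_level_algebras_weak_lefschetz:
  assumes "e \<ge> 4"
  shows "\<not> level_algebras_weak_lefschetz TYPE('k) 2 3 e"
proof
  assume *: "level_algebras_weak_lefschetz TYPE('k) 2 3 e"
  have "int 4 \<le> e" using assms by simp
  with homogeneous_ideal apolar_artinian apolar_codimension apolar_level
  have "weak_lefschetz A gr"
    using *[unfolded level_algebras_weak_lefschetz_def Let_def, rule_format, of 3 apolar_ideal 4] by blast
  then show False using apolar_not_weak_lefschetz by blast
qed

end

lemma level_algebras_weak_lefschetz_imp_le_3:
  assumes "level_algebras_weak_lefschetz TYPE('k::field) 2 3 e"
  shows "e \<le> 3"
proof (rule ccontr)
  assume "\<not> e \<le> 3"
  moreover have gq: "apolar_quotient TYPE('k)"
    unfolding apolar_quotient_def by (rule apolar_graded_quotient)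
  ultimately show False
    using apolar_quotient.not_level_algebras_weak_lefschetz[OF gq, of e] assms by simp
qed

theorem proposition4p5:
  shows "is_e TYPE('k::field_char_0) 2 3 3"
  using level_algebras_weak_lefschetz_3 level_algebras_weak_lefschetz_imp_le_3
  unfolding is_e_def by blast

end
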